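(* Let $\varphi \in L^\infty$. Then $H_\varphi \in \mathcal{AN}(H^2)$ if and only if $H_\varphi \in \mathcal{K}(H^2)$, i.e. $H_\varphi$ is absolutely norm attaining if and only if it is compact.
   Context: Let $\mathbb{T}$ be the unit circle in $\mathbb{C}$ with normalized Lebesgue measure $\mu$. $L^2$ is the Hilbert space of complex-valued square integrable functions on $\mathbb{T}$ with respect to $\mu$, and $L^\infty$ is the Banach space of complex-valued essentially bounded $\mu$-measurable functions on $\mathbb{T}$. $H^2$ is the closed subspace of $L^2$ of all functions whose negative Fourier coefficients vanish, $P$ is the orthogonal projection of $L^2$ onto $H^2$, $I$ is the identity operator, and $J$ is the unitary operator on $L^2$ determined by $J(z^{-n}) = z^{n-1}$ for all $n \in \mathbb{Z}$. For $\varphi \in L^\infty$ the Hankel operator $H_\varphi : H^2 \to H^2$ is $H_\varphi f = J(I-P)(\varphi f)$, where $(\varphi f)(z) = \varphi(z) f(z)$. $\mathcal{K}(H^2)$ denotes the set of compact operators on $H^2$. A bounded linear operator $T : H_1 \to H_2$ between Hilbert spaces is norm attaining if there is a unit vector $x \in H_1$ with $\|Tx\| = \|T\|$. It is absolutely norm attaining (an $\mathcal{AN}$-operator) if for every nonzero closed subspace $M$ of $H_1$ the restriction $T|_M : M \to H_2$ is norm attaining. $\mathcal{AN}(H^2)$ denotes the set of all $\mathcal{AN}$-operators from $H^2$ to $H^2$. *)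

theory Defs
  imports "HOL-Analysis.Analysis"
begin

text \<open>Normalized Lebesgue measure on the unit circle: the completion of the image of Lebesgue
  measure on \<open>[0,1)\<close> under \<open>t \<mapsto> exp (2 \<pi> i t)\<close>.\<close>

definition circle_measure :: "complex measure" where
  "circle_measure = completion (distr (restrict_space lborel {0..<1})
     (restrict_space borel (sphere 0 1)) (\<lambda>t. cis (2 * pi * t)))"

lemma cis_measurable_circle:
  "(\<lambda>t. cis (2 * pi * t)) \<in>
     measurable (restrict_space lborel {0..<1}) (restrict_space borel (sphere 0 1))"
  by (intro measurable_restrict_space3)
     (auto intro!: borel_measurable_continuous_onI continuous_intros simp: measurable_lborel1)

lemma space_circle_measure [simp]: "space circle_measure = sphere 0 1"
  by (simp add: circle_measure_def space_restrict_space)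

lemma emeasure_circle_measure: "emeasure circle_measure (sphere 0 1) = 1"
proof -
  have *: "sphere 0 1 \<in> sets (restrict_space borel (sphere 0 1 :: complex set))"
    by (auto simp: sets_restrict_space intro!: image_eqI[of _ _ UNIV])
  have "(\<lambda>t. cis (2 * pi * t)) -` sphere 0 1 \<inter> space (restrict_space lborel {0..<1::real}) = {0..<1}"
    by (auto simp: space_restrict_space)
  then show ?thesis
    using * cis_measurable_circle
    by (simp add: circle_measure_def emeasure_distr emeasure_restrict_space)
qed

lemma finite_measure_circle: "finite_measure circle_measure"
  by (rule finite_measureI) (simp add: emeasure_circle_measure)

definition square_integrable :: "(complex \<Rightarrow> complex) \<Rightarrow> bool" where
  "square_integrable f \<longleftrightarrow>
     f \<in> borel_measurable circle_measure \<and> integrable circle_measure (\<lambda>z. (cmod (f z))\<^sup>2)"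

definition ess_bounded :: "(complex \<Rightarrow> complex) \<Rightarrow> bool" where
  "ess_bounded f \<longleftrightarrow>
     f \<in> borel_measurable circle_measure \<and> (\<exists>C. AE z in circle_measure. cmod (f z) \<le> C)"

lemma square_integrable_measurable [measurable_dest]:
  "square_integrable f \<Longrightarrow> f \<in> borel_measurable circle_measure"
  by (simp add: square_integrable_def)

lemma square_integrable_0: "square_integrable (\<lambda>_. 0)"
  by (simp add: square_integrable_def)

lemma square_integrable_mult_integrable:
  assumes "square_integrable f" "square_integrable g"
  shows "integrable circle_measure (\<lambda>z. f z * cnj (g z))"
proof (rule Bochner_Integration.integrable_bound)
  show "integrable circle_measure (\<lambda>z. (cmod (f z))\<^sup>2 + (cmod (g z))\<^sup>2)"
    using assms by (simp add: square_integrable_def)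
  have *: "g \<in> borel_measurable circle_measure" "f \<in> borel_measurable circle_measure"
    using assms by (auto simp: square_integrable_def)
  have "(\<lambda>z. cnj (g z)) \<in> borel_measurable circle_measure"
    by (rule measurable_compose[OF *(1)])
       (intro borel_measurable_continuous_onI continuous_intros)
  with * show "(\<lambda>z. f z * cnj (g z)) \<in> borel_measurable circle_measure" by simp
  have "a * b \<le> a\<^sup>2 + b\<^sup>2" for a b :: real
  proof -
    have "2 * (a * b) \<le> a\<^sup>2 + b\<^sup>2" using sum_squares_bound[of a b] by simp
    then show ?thesis using sum_power2_ge_zero[of a b] by linarith
  qed
  then show "AE z in circle_measure.
      norm (f z * cnj (g z)) \<le> norm ((cmod (f z))\<^sup>2 + (cmod (g z))\<^sup>2)"
    by (auto simp: norm_mult)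
qed

lemma square_integrable_mult:
  assumes "ess_bounded p" "square_integrable f"
  shows "square_integrable (\<lambda>z. p z * f z)"
proof -
  obtain C where C: "AE z in circle_measure. cmod (p z) \<le> C"
    using assms by (auto simp: ess_bounded_def)
  have m: "p \<in> borel_measurable circle_measure" "f \<in> borel_measurable circle_measure"
    using assms by (auto simp: square_integrable_def ess_bounded_def)
  have "integrable circle_measure (\<lambda>z. (cmod (p z * f z))\<^sup>2)"
  proof (rule Bochner_Integration.integrable_bound)
    show "integrable circle_measure (\<lambda>z. C\<^sup>2 * (cmod (f z))\<^sup>2)"
      using assms by (simp add: square_integrable_def)
    show "(\<lambda>z. (cmod (p z * f z))\<^sup>2) \<in> borel_measurable circle_measure"
      using m by simp
    show "AE z in circle_measure. norm ((cmod (p z * f z))\<^sup>2) \<le> norm (C\<^sup>2 * (cmod (f z))\<^sup>2)"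
      using C
      by eventually_elim
         (auto simp: norm_mult power_mult_distrib intro!: mult_right_mono power_mono)
  qed
  with m show ?thesis by (simp add: square_integrable_def)
qed

lemma ess_bounded_const: "ess_bounded (\<lambda>_. c)"
  by (auto simp: ess_bounded_def)

lemma square_integrable_scale:
  "square_integrable f \<Longrightarrow> square_integrable (\<lambda>z. c * f z)"
  using square_integrable_mult[OF ess_bounded_const] .

lemma square_integrable_add:
  assumes "square_integrable f" "square_integrable g"
  shows "square_integrable (\<lambda>z. f z + g z)"
proof -
  have m: "f \<in> borel_measurable circle_measure" "g \<in> borel_measurable circle_measure"
    using assms by (auto simp: square_integrable_def)
  have "integrable circle_measure (\<lambda>z. (cmod (f z + g z))\<^sup>2)"
  proof (rule Bochner_Integration.integrable_bound)
    show "integrable circle_measure (\<lambda>z. 2 * (cmod (f z))\<^sup>2 + 2 * (cmod (g z))\<^sup>2)"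
      using assms by (simp add: square_integrable_def)
    show "(\<lambda>z. (cmod (f z + g z))\<^sup>2) \<in> borel_measurable circle_measure"
      using m by simp
    have "(cmod (a + b))\<^sup>2 \<le> 2 * (cmod a)\<^sup>2 + 2 * (cmod b)\<^sup>2" for a b
    proof -
      have "(cmod (a + b))\<^sup>2 \<le> (cmod a + cmod b)\<^sup>2"
        by (intro power_mono norm_triangle_ineq) simp
      also have "\<dots> \<le> 2 * (cmod a)\<^sup>2 + 2 * (cmod b)\<^sup>2"
        using sum_squares_bound[of "cmod a" "cmod b"] by (simp add: power2_sum)
      finally show ?thesis .
    qed
    then show "AE z in circle_measure.
        norm ((cmod (f z + g z))\<^sup>2) \<le> norm (2 * (cmod (f z))\<^sup>2 + 2 * (cmod (g z))\<^sup>2)"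
      by auto
  qed
  with m show ?thesis by (simp add: square_integrable_def)
qed

lemma ess_bounded_powi: "ess_bounded (\<lambda>z. z powi n)"
proof -
  have "(\<lambda>z::complex. z powi n) \<in> borel_measurable (restrict_space borel (sphere 0 1))"
    by (intro borel_measurable_continuous_on_restrict continuous_intros) auto
  then have "(\<lambda>z::complex. z powi n) \<in> borel_measurable circle_measure"
    unfolding circle_measure_def by (intro measurable_completion) simp
  moreover have "AE z in circle_measure. cmod (z powi n) \<le> 1"
    by (rule AE_I2) (simp add: norm_power_int)
  ultimately show ?thesis by (auto simp: ess_bounded_def)
qed

lemma square_integrable_powi: "square_integrable (\<lambda>z. z powi n)"
proof -
  have "square_integrable (\<lambda>_. 1)"
    using finite_measure.integrable_const[OF finite_measure_circle, of "1::real"]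
    by (simp add: square_integrable_def)
  from square_integrable_mult[OF ess_bounded_powi this] show ?thesis by simp
qed

quotient_type ltwo = "complex \<Rightarrow> complex" /
  partial: "\<lambda>f g. square_integrable f \<and> square_integrable g \<and> (AE z in circle_measure. f z = g z)"
proof (rule part_equivpI)
  show "\<exists>f. square_integrable f \<and> square_integrable f \<and> (AE z in circle_measure. f z = f z)"
    using square_integrable_0 by auto
  show "symp (\<lambda>f g. square_integrable f \<and> square_integrable g \<and> (AE z in circle_measure. f z = g z))"
    by (auto simp: symp_def)
  show "transp (\<lambda>f g. square_integrable f \<and> square_integrable g \<and> (AE z in circle_measure. f z = g z))"
    unfolding transp_def
  proof (intro allI impI, elim conjE, intro conjI)
    fix f g h assume "AE z in circle_measure. f z = g z" "AE z in circle_measure. g z = h z"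
    then show "AE z in circle_measure. f z = h z" by eventually_elim simp
  qed auto
qed

quotient_type linf = "complex \<Rightarrow> complex" /
  partial: "\<lambda>f g. ess_bounded f \<and> ess_bounded g \<and> (AE z in circle_measure. f z = g z)"
proof (rule part_equivpI)
  show "\<exists>f. ess_bounded f \<and> ess_bounded f \<and> (AE z in circle_measure. f z = f z)"
    using ess_bounded_const by auto
  show "symp (\<lambda>f g. ess_bounded f \<and> ess_bounded g \<and> (AE z in circle_measure. f z = g z))"
    by (auto simp: symp_def)
  show "transp (\<lambda>f g. ess_bounded f \<and> ess_bounded g \<and> (AE z in circle_measure. f z = g z))"
    unfolding transp_def
  proof (intro allI impI, elim conjE, intro conjI)
    fix f g h assume "AE z in circle_measure. f z = g z" "AE z in circle_measure. g z = h z"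
    then show "AE z in circle_measure. f z = h z" by eventually_elim simp
  qed auto
qed

text \<open>The complex inner product, linear in the first argument. The real inner product of the class
  \<open>real_inner\<close> is its real part; it induces the same norm.\<close>

lift_definition cinner :: "ltwo \<Rightarrow> ltwo \<Rightarrow> complex" is
  "\<lambda>f g. \<integral>z. f z * cnj (g z) \<partial>circle_measure"
proof (elim conjE)
  fix f f' g g'
  assume s: "square_integrable f" "square_integrable f'"
            "square_integrable g" "square_integrable g'"
    and eq: "AE z in circle_measure. f z = f' z" "AE z in circle_measure. g z = g' z"
  show "(\<integral>z. f z * cnj (g z) \<partial>circle_measure) = (\<integral>z. f' z * cnj (g' z) \<partial>circle_measure)"
  proof (rule integral_cong_AE)
    show "(\<lambda>z. f z * cnj (g z)) \<in> borel_measurable circle_measure"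
         "(\<lambda>z. f' z * cnj (g' z)) \<in> borel_measurable circle_measure"
      using s by (auto intro!: borel_measurable_integrable square_integrable_mult_integrable)
    show "AE z in circle_measure. f z * cnj (g z) = f' z * cnj (g' z)"
      using eq by eventually_elim simp
  qed
qed

lift_definition scaleC :: "complex \<Rightarrow> ltwo \<Rightarrow> ltwo" is "\<lambda>c f z. c * f z"
  by (auto intro: square_integrable_scale)

instantiation ltwo :: real_inner
begin

lift_definition zero_ltwo :: ltwo is "\<lambda>_. 0"
  by (simp add: square_integrable_0)

lift_definition plus_ltwo :: "ltwo \<Rightarrow> ltwo \<Rightarrow> ltwo" is "\<lambda>f g z. f z + g z"
  by (auto intro: square_integrable_add elim: eventually_elim2)

lift_definition uminus_ltwo :: "ltwo \<Rightarrow> ltwo" is "\<lambda>f z. - f z"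
  using square_integrable_scale[of _ "-1"] by auto

lift_definition minus_ltwo :: "ltwo \<Rightarrow> ltwo \<Rightarrow> ltwo" is "\<lambda>f g z. f z - g z"
proof (elim conjE, intro conjI)
  fix f f' g g'
  assume s: "square_integrable f" "square_integrable f'"
            "square_integrable g" "square_integrable g'"
    and eq: "AE z in circle_measure. f z = f' z" "AE z in circle_measure. g z = g' z"
  show "square_integrable (\<lambda>z. f z - g z)" "square_integrable (\<lambda>z. f' z - g' z)"
    using square_integrable_add[OF s(1) square_integrable_scale[OF s(3), of "-1"]]
          square_integrable_add[OF s(2) square_integrable_scale[OF s(4), of "-1"]] by auto
  show "AE z in circle_measure. f z - g z = f' z - g' z"
    using eq by eventually_elim simp
qed

definition scaleR_ltwo :: "real \<Rightarrow> ltwo \<Rightarrow> ltwo" where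
  "scaleR_ltwo r f = scaleC (complex_of_real r) f"

definition inner_ltwo :: "ltwo \<Rightarrow> ltwo \<Rightarrow> real" where
  "inner_ltwo f g = Re (cinner f g)"

definition norm_ltwo :: "ltwo \<Rightarrow> real" where
  "norm_ltwo f = sqrt (inner f f)"

definition dist_ltwo :: "ltwo \<Rightarrow> ltwo \<Rightarrow> real" where
  "dist_ltwo f g = norm (f - g)"

definition sgn_ltwo :: "ltwo \<Rightarrow> ltwo" where
  "sgn_ltwo f = inverse (norm f) *\<^sub>R f"

definition uniformity_ltwo :: "(ltwo \<times> ltwo) filter" where
  "uniformity_ltwo = (INF e\<in>{0 <..}. principal {(x, y). dist x y < e})"

definition open_ltwo :: "ltwo set \<Rightarrow> bool" where
  "open_ltwo U \<longleftrightarrow> (\<forall>x\<in>U. eventually (\<lambda>(x', y). x' = x \<longrightarrow> y \<in> U) uniformity)"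

instance
proof
  fix f g h :: ltwo and a b :: real
  note si = square_integrable_scale square_integrable_add square_integrable_0
  show "f + g + h = f + (g + h)" by transfer (auto intro!: si simp: add.assoc)
  show "f + g = g + f" by transfer (auto intro!: si simp: add.commute)
  show "0 + f = f" by transfer (auto intro!: si)
  show "- f + f = 0"
    by transfer (auto intro!: si simp: square_integrable_0)
  show "f - g = f + - g"
  proof transfer
    fix f g
    assume "square_integrable f \<and> square_integrable f \<and> (AE z in circle_measure. f z = f z)"
      "square_integrable g \<and> square_integrable g \<and> (AE z in circle_measure. g z = g z)"
    then show "square_integrable (\<lambda>z. f z - g z) \<and> square_integrable (\<lambda>z. f z + - g z) \<and>
        (AE z in circle_measure. f z - g z = f z + - g z)"
      using square_integrable_add[OF _ square_integrable_scale[of g "-1"], of f] by auto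
  qed
  show "a *\<^sub>R (f + g) = a *\<^sub>R f + a *\<^sub>R g"
    unfolding scaleR_ltwo_def by transfer (auto intro!: si simp: distrib_left)
  show "(a + b) *\<^sub>R f = a *\<^sub>R f + b *\<^sub>R f"
    unfolding scaleR_ltwo_def by transfer (auto intro!: si simp: distrib_right)
  show "a *\<^sub>R b *\<^sub>R f = (a * b) *\<^sub>R f"
    unfolding scaleR_ltwo_def by transfer (auto intro!: si simp: mult.assoc)
  show "1 *\<^sub>R f = f"
    unfolding scaleR_ltwo_def by transfer auto
  show "dist f g = norm (f - g)" by (rule dist_ltwo_def)
  show "sgn f = inverse (norm f) *\<^sub>R f" by (rule sgn_ltwo_def)
  show "uniformity = (INF e\<in>{0 <..}. principal {(x, y::ltwo). dist x y < e})"
    by (rule uniformity_ltwo_def)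
  show "open U \<longleftrightarrow> (\<forall>x\<in>U. \<forall>\<^sub>F (x', y) in uniformity. x' = x \<longrightarrow> y \<in> U)" for U :: "ltwo set"
    by (rule open_ltwo_def)
  have cinner_commute: "cinner f g = cnj (cinner g f)"
    by transfer (subst Bochner_Integration.integral_cnj [symmetric], simp add: mult.commute)
  show "inner f g = inner g f"
    unfolding inner_ltwo_def by (subst cinner_commute) simp
  have "cinner (f + g) h = cinner f h + cinner g h"
    by transfer (simp add: distrib_right square_integrable_mult_integrable)
  then show "inner (f + g) h = inner f h + inner g h"
    by (simp add: inner_ltwo_def)
  have "cinner (scaleC c f) g = c * cinner f g" for c
    by transfer (simp add: mult.assoc)
  then show "inner (a *\<^sub>R f) g = a * inner f g"
    by (simp add: inner_ltwo_def scaleR_ltwo_def)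
  have sq: "f z * cnj (f z) = complex_of_real ((cmod (f z))\<^sup>2)" for f z
    by (simp only: complex_norm_square)
  have nonneg: "0 \<le> Re (cinner f f)"
    by transfer (simp only: sq integral_complex_of_real Re_complex_of_real, simp)
  then show "0 \<le> inner f f" by (simp add: inner_ltwo_def)
  have "Re (cinner f f) = 0 \<longleftrightarrow> f = 0"
  proof transfer
    fix f assume *: "square_integrable f \<and> square_integrable f \<and> (AE z in circle_measure. f z = f z)"
    have "Re (\<integral>z. f z * cnj (f z) \<partial>circle_measure) = (\<integral>z. (cmod (f z))\<^sup>2 \<partial>circle_measure)"
      by (simp only: sq integral_complex_of_real Re_complex_of_real)
    also have "\<dots> = 0 \<longleftrightarrow> (AE z in circle_measure. (cmod (f z))\<^sup>2 = 0)"
      using * by (intro integral_nonneg_eq_0_iff_AE) (auto simp: square_integrable_def)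
    finally show "Re (\<integral>z. f z * cnj (f z) \<partial>circle_measure) = 0 \<longleftrightarrow>
      square_integrable f \<and> square_integrable (\<lambda>_. 0) \<and> (AE z in circle_measure. f z = 0)"
      using * square_integrable_0 by simp
  qed
  then show "inner f f = 0 \<longleftrightarrow> f = 0" by (simp add: inner_ltwo_def)
  show "norm f = sqrt (inner f f)" by (rule norm_ltwo_def)
qed

end

lift_definition zpow :: "int \<Rightarrow> ltwo" is "\<lambda>n z. z powi n"
  by (simp add: square_integrable_powi)

lift_definition linf_mult :: "linf \<Rightarrow> ltwo \<Rightarrow> ltwo" is "\<lambda>p f z. p z * f z"
  by (auto intro: square_integrable_mult elim: eventually_elim2)

text \<open>An operator between subspaces \<open>S\<close> and \<open>R\<close> is represented by a function on all of
  \<open>L\<^sup>2\<close>, of which only the values on \<open>S\<close> matter. Linearity is over the complex numbers.\<close>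

definition csubspace :: "ltwo set \<Rightarrow> bool" where
  "csubspace S \<longleftrightarrow>
     0 \<in> S \<and> (\<forall>x\<in>S. \<forall>y\<in>S. x + y \<in> S) \<and> (\<forall>c. \<forall>x\<in>S. scaleC c x \<in> S)"

definition clinear_on :: "ltwo set \<Rightarrow> (ltwo \<Rightarrow> ltwo) \<Rightarrow> bool" where
  "clinear_on S T \<longleftrightarrow>
     (\<forall>x\<in>S. \<forall>y\<in>S. T (x + y) = T x + T y) \<and> (\<forall>c. \<forall>x\<in>S. T (scaleC c x) = scaleC c (T x))"

definition bounded_operators :: "ltwo set \<Rightarrow> ltwo set \<Rightarrow> (ltwo \<Rightarrow> ltwo) set" where
  "bounded_operators S R =
     {T. T ` S \<subseteq> R \<and> clinear_on S T \<and> (\<exists>K. \<forall>x\<in>S. norm (T x) \<le> K * norm x)}"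

text \<open>The operator norm of the restriction of \<open>T\<close> to \<open>M\<close>; \<open>onorm\<close> is the case
  \<open>M = UNIV\<close>.\<close>

definition onorm_on :: "ltwo set \<Rightarrow> (ltwo \<Rightarrow> ltwo) \<Rightarrow> real" where
  "onorm_on M T = (SUP x\<in>M. norm (T x) / norm x)"

definition norm_attaining_on :: "ltwo set \<Rightarrow> (ltwo \<Rightarrow> ltwo) \<Rightarrow> bool" where
  "norm_attaining_on M T \<longleftrightarrow> (\<exists>x\<in>M. norm x = 1 \<and> norm (T x) = onorm_on M T)"

definition AN_operators :: "ltwo set \<Rightarrow> ltwo set \<Rightarrow> (ltwo \<Rightarrow> ltwo) set" where
  "AN_operators S R = {T \<in> bounded_operators S R.
     \<forall>M. csubspace M \<and> closed M \<and> M \<subseteq> S \<and> M \<noteq> {0} \<longrightarrow> norm_attaining_on M T}"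

definition compact_operators :: "ltwo set \<Rightarrow> ltwo set \<Rightarrow> (ltwo \<Rightarrow> ltwo) set" where
  "compact_operators S R = {T \<in> bounded_operators S R. compact (closure (T ` (S \<inter> cball 0 1)))}"

definition unitary_operator :: "(ltwo \<Rightarrow> ltwo) \<Rightarrow> bool" where
  "unitary_operator U \<longleftrightarrow>
     clinear_on UNIV U \<and> surj U \<and> (\<forall>f g. cinner (U f) (U g) = cinner f g)"

definition orthogonal_projection :: "ltwo set \<Rightarrow> ltwo \<Rightarrow> ltwo" where
  "orthogonal_projection S f = (THE g. g \<in> S \<and> (\<forall>h\<in>S. cinner (f - g) h = 0))"

definition fourier_coeff :: "ltwo \<Rightarrow> int \<Rightarrow> complex" where
  "fourier_coeff f n = cinner f (zpow n)"

definition hardy2 :: "ltwo set" where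
  "hardy2 = {f. \<forall>n<0. fourier_coeff f n = 0}"

definition flip_operator :: "ltwo \<Rightarrow> ltwo" where
  "flip_operator = (THE U. unitary_operator U \<and> (\<forall>n. U (zpow (- n)) = zpow (n - 1)))"

definition hankel :: "linf \<Rightarrow> ltwo \<Rightarrow> ltwo" where
  "hankel \<phi> f = flip_operator (linf_mult \<phi> f - orthogonal_projection hardy2 (linf_mult \<phi> f))"

end

(*
If H is a bounded operator and M a closed subspace, the parallelogram law shows that a maximizing
sequence of unit vectors in M with convergent images is Cauchy; hence compact operators are
absolutely norm attaining.

Conversely, H_phi z^n is the J-image of the part of phi z^n orthogonal to H^2, and tends to 0
because trigonometric polynomials are dense.  If H were not compact, then on the joint kernel of any
finitely many functionals norm (H g) would take, on unit vectors, values near 0 (close to the z^n) and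
values above a fixed beta.  The unit sphere being connected, one can choose successively g_0, g_1, ...
orthonormal, with H g_0, H g_1, ... orthogonal and norm (H g_k) strictly increasing to beta.
On the closed span of the g_k the norm of H is beta and is not attained.
*)
theory Submission
  imports Defs
begin

section \<open>The Hilbert space structure\<close>

text \<open>The identity on \<open>H^2\<close> is absolutely norm attaining without being compact,
  so the converse must use something special about Hankel operators. All that it uses is that the
  monomials are weakly null unit vectors whose images tend to 0. The number \<beta> has to be fixed
  before the finite families of functionals are known. It comes from a sequence in the image of the
  unit ball whose terms are at least \<open>d\<close> apart. On a subsequence along which the given
  functionals converge, differences of neighbours lie almost in the joint kernel, have norm at most
  2, and have images of norm at least \<open>d\<close>. Hence \<open>d / 8\<close> serves every
  family at once. Orthogonality of images is imposed through the functionals that map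
  \<open>x\<close> to \<open>cinner (T x) (T a)\<close>, so no adjoint has to be constructed. The
  projection and \<open>J\<close> are given by definite descriptions. They can be used only after
  unique existence is known: for the projection this rests on completeness of \<open>L^2\<close>,
  and for \<open>J\<close> on the fact that Fourier coefficients determine a function.\<close>

lemma cinner_commute: "cinner f g = cnj (cinner g f)"
  by transfer (subst Bochner_Integration.integral_cnj [symmetric], simp add: mult.commute)

lemma cinner_add_left: "cinner (f + g) h = cinner f h + cinner g h"
  by transfer (simp add: distrib_right square_integrable_mult_integrable)

lemma cinner_scaleC_left: "cinner (scaleC c f) g = c * cinner f g"
  by transfer (simp add: mult.assoc)

lemma cinner_add_right: "cinner h (f + g) = cinner h f + cinner h g"
  by (metis cinner_add_left cinner_commute complex_cnj_add)

lemma cinner_scaleC_right: "cinner f (scaleC c g) = cnj c * cinner f g"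
  by (metis cinner_scaleC_left cinner_commute complex_cnj_mult)

lemma scaleC_of_real: "scaleC (of_real r) f = r *\<^sub>R f"
  by (simp add: scaleR_ltwo_def)

lemma scaleC_one [simp]: "scaleC 1 f = f"
  using scaleC_of_real[of 1 f] by simp

lemma scaleC_zero_left [simp]: "scaleC 0 f = 0"
  using scaleC_of_real[of 0 f] by simp

lemma scaleC_minus_one: "scaleC (-1) f = - f"
  using scaleC_of_real[of "-1" f] by simp

lemma scaleC_scaleC: "scaleC a (scaleC b f) = scaleC (a * b) f"
  by transfer (auto intro: square_integrable_scale simp: mult.assoc)

lemma scaleC_add_right: "scaleC c (f + g) = scaleC c f + scaleC c g"
  by transfer (auto intro!: square_integrable_scale square_integrable_add simp: distrib_left)

lemma scaleC_add_left: "scaleC (a + b) f = scaleC a f + scaleC b f"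
  by transfer (auto intro!: square_integrable_scale square_integrable_add simp: distrib_right)

lemma scaleC_zero_right [simp]: "scaleC c 0 = 0"
  using scaleC_add_right[of c 0 0] by simp

lemma scaleC_diff_right: "scaleC c (f - g) = scaleC c f - scaleC c g"
  using scaleC_add_right[of c "f - g" g] by simp

lemma cinner_zero_left [simp]: "cinner 0 g = 0"
  using cinner_add_left[of 0 0 g] by simp

lemma cinner_zero_right [simp]: "cinner g 0 = 0"
  using cinner_add_right[of g 0 0] by simp

lemma cinner_diff_left: "cinner (f - g) h = cinner f h - cinner g h"
  using cinner_add_left[of "f - g" g h] by simp

lemma cinner_diff_right: "cinner h (f - g) = cinner h f - cinner h g"
  using cinner_add_right[of h "f - g" g] by simp

lemma cinner_same: "cinner f f = of_real ((norm f)\<^sup>2)"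
proof -
  have "Im (cinner f f) = 0"
    using arg_cong[OF cinner_commute[of f f], of Im] by simp
  then show ?thesis
    by (simp add: complex_eq_iff power2_norm_eq_inner inner_ltwo_def)
qed

lemma norm_scaleC [simp]: "norm (scaleC c f) = cmod c * norm f"
proof -
  have "complex_of_real ((norm (scaleC c f))\<^sup>2) = of_real ((cmod c * norm f)\<^sup>2)"
    by (simp only: cinner_same[symmetric] cinner_scaleC_left cinner_scaleC_right
        power_mult_distrib of_real_mult complex_norm_square mult_ac)
  then have "(norm (scaleC c f))\<^sup>2 = (cmod c * norm f)\<^sup>2"
    by (simp only: of_real_eq_iff)
  then show ?thesis by (simp add: power2_eq_iff_nonneg)
qed

text \<open>Multiplying \<open>f\<close> by the unimodular number \<open>c\<close> turns
  \<open>cinner f g\<close> into its modulus. The inequality for the real inner product then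
  applies.\<close>

lemma cinner_Cauchy_Schwarz: "cmod (cinner f g) \<le> norm f * norm g"
proof (cases "cinner f g = 0")
  case False
  define c where "c = cnj (cinner f g) / cmod (cinner f g)"
  have c: "cmod c = 1" using False by (simp add: c_def norm_divide)
  have "cinner (scaleC c f) g = cmod (cinner f g)"
    using False
    by (simp add: cinner_scaleC_left c_def complex_norm_square[symmetric] power2_eq_square
        mult.commute[of "cnj _"])
  then have "cmod (cinner f g) = inner (scaleC c f) g" by (simp add: inner_ltwo_def)
  also have "\<dots> \<le> norm (scaleC c f) * norm g" by (rule norm_cauchy_schwarz)
  finally show ?thesis using c by simp
qed simp

lemma pythagoras_cinner:
  assumes "cinner f g = 0"
  shows "(norm (f + g))\<^sup>2 = (norm f)\<^sup>2 + (norm g)\<^sup>2"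
  using assms by (simp add: power2_norm_eq_inner inner_add inner_commute[of g f] inner_ltwo_def[of f g])

lemma parallelogram_law:
  fixes f g :: "'a::real_inner"
  shows "(norm (f + g))\<^sup>2 + (norm (f - g))\<^sup>2 = 2 * (norm f)\<^sup>2 + 2 * (norm g)\<^sup>2"
  by (simp add: power2_norm_eq_inner inner_add inner_diff inner_commute[of g f])

lemma tendsto_cinner_left:
  assumes "(X \<longlongrightarrow> f) F"
  shows "((\<lambda>n. cinner (X n) g) \<longlongrightarrow> cinner f g) F"
proof -
  have "((\<lambda>n. norm (X n - f) * norm g) \<longlongrightarrow> 0) F"
    using assms by (intro tendsto_mult_left_zero tendsto_norm_zero LIM_zero)
  then have "((\<lambda>n. cinner (X n - f) g) \<longlongrightarrow> 0) F"
    by (rule Lim_null_comparison[rotated]) (simp add: cinner_Cauchy_Schwarz)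
  then show ?thesis by (simp add: cinner_diff_left LIM_zero_cancel)
qed

lemma tendsto_cinner_right:
  assumes "(X \<longlongrightarrow> f) F"
  shows "((\<lambda>n. cinner g (X n)) \<longlongrightarrow> cinner g f) F"
  using tendsto_cnj[OF tendsto_cinner_left[OF assms, of g]] by (simp add: cinner_commute[symmetric])

lemma tendsto_scaleC:
  assumes "(X \<longlongrightarrow> f) F"
  shows "((\<lambda>n. scaleC c (X n)) \<longlongrightarrow> scaleC c f) F"
proof -
  have "((\<lambda>n. cmod c * norm (X n - f)) \<longlongrightarrow> 0) F"
    using assms by (intro tendsto_mult_right_zero tendsto_norm_zero LIM_zero)
  then have "((\<lambda>n. scaleC c (X n - f)) \<longlongrightarrow> 0) F"
    by (rule Lim_null_comparison[rotated]) simp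
  then show ?thesis by (simp add: scaleC_diff_right LIM_zero_cancel)
qed

section \<open>Representatives and completeness of \<open>L^2\<close>\<close>

lemma rep_ltwo:
  obtains f where "square_integrable f" "abs_ltwo f = F"
  using Quotient_rep_reflp[OF Quotient_ltwo, of F] Quotient_abs_rep[OF Quotient_ltwo, of F] by blast

lemma cinner_abs_ltwo:
  assumes "square_integrable f" "square_integrable g"
  shows "cinner (abs_ltwo f) (abs_ltwo g) = (\<integral>z. f z * cnj (g z) \<partial>circle_measure)"
  using assms by (simp add: cinner.abs_eq eq_onp_same_args)

lemma norm_abs_ltwo:
  assumes "square_integrable f"
  shows "(norm (abs_ltwo f))\<^sup>2 = (\<integral>z. (cmod (f z))\<^sup>2 \<partial>circle_measure)"
proof -
  have "complex_of_real ((norm (abs_ltwo f))\<^sup>2) = (\<integral>z. of_real ((cmod (f z))\<^sup>2) \<partial>circle_measure)"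
    by (simp only: cinner_same[symmetric] cinner_abs_ltwo[OF assms assms] complex_norm_square)
  then show ?thesis
    by (simp only: integral_complex_of_real of_real_eq_iff)
qed

lemma square_integrable_diff:
  assumes "square_integrable f" "square_integrable g"
  shows "square_integrable (\<lambda>z. f z - g z)"
  using square_integrable_add[OF assms(1) square_integrable_scale[OF assms(2), of "-1"]] by simp

lemma diff_abs_ltwo:
  assumes "square_integrable f" "square_integrable g"
  shows "abs_ltwo f - abs_ltwo g = abs_ltwo (\<lambda>z. f z - g z)"
  using assms by (simp add: minus_ltwo.abs_eq)

lemma abs_ltwo_eq_zero:
  assumes "square_integrable f" "AE z in circle_measure. f z = 0"
  shows "abs_ltwo f = 0"
  unfolding zero_ltwo_def using assms square_integrable_0
  by (intro Quotient_rel_abs[OF Quotient_ltwo]) blast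

lemma square_integrable_integrable:
  assumes "square_integrable f"
  shows "integrable circle_measure f"
  using square_integrable_mult_integrable[OF assms square_integrable_powi[of 0]] by simp

text \<open>Cauchy-Schwarz for the modulus of \<open>f\<close> against the constant 1, which has
  norm 1 because the measure is normalized. It turns Cauchy sequences of \<open>L^2\<close> into
  Cauchy sequences of \<open>L^1\<close>, which have subsequences that converge almost
  everywhere.\<close>

lemma integral_norm_le_norm_ltwo:
  assumes "square_integrable f"
  shows "(\<integral>z. cmod (f z) \<partial>circle_measure) \<le> norm (abs_ltwo f)"
proof -
  define g where "g = (\<lambda>z. complex_of_real (cmod (f z)))"
  have g: "square_integrable g" using assms by (auto simp: g_def square_integrable_def)
  have "(norm (abs_ltwo g))\<^sup>2 = (norm (abs_ltwo f))\<^sup>2"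
    using norm_abs_ltwo[OF g] norm_abs_ltwo[OF assms] by (simp add: g_def)
  then have n: "norm (abs_ltwo g) = norm (abs_ltwo f)"
    by (rule power2_eq_imp_eq) simp_all
  have one: "square_integrable (\<lambda>_. 1)" using square_integrable_powi[of 0] by simp
  have "(norm (abs_ltwo (\<lambda>_. 1)))\<^sup>2 = 1\<^sup>2"
    using norm_abs_ltwo[OF one] by (simp add: measure_def emeasure_circle_measure)
  then have "norm (abs_ltwo (\<lambda>_. 1)) = 1"
    by (rule power2_eq_imp_eq) simp_all
  moreover have "cinner (abs_ltwo g) (abs_ltwo (\<lambda>_. 1)) = (\<integral>z. cmod (f z) \<partial>circle_measure)"
    using g one by (simp add: cinner_abs_ltwo) (simp add: g_def)
  ultimately show ?thesis
    using cinner_Cauchy_Schwarz[of "abs_ltwo g" "abs_ltwo (\<lambda>_. 1)"] n by simp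
qed

text \<open>The Riesz-Fischer argument: the limit is found pointwise along a subsequence, and its
  distance to the sequence is controlled by Fatou's lemma.\<close>

instance ltwo :: complete_space
proof
  fix X :: "nat \<Rightarrow> ltwo" assume X: "Cauchy X"
  have "\<exists>f. square_integrable f \<and> abs_ltwo f = X n" for n using rep_ltwo by blast
  then obtain s where s: "\<And>n. square_integrable (s n)" "\<And>n. abs_ltwo (s n) = X n" by metis
  have dist: "(norm (X i - X j))\<^sup>2 = (\<integral>z. (cmod (s i z - s j z))\<^sup>2 \<partial>circle_measure)" for i j
    using norm_abs_ltwo[OF square_integrable_diff[OF s(1) s(1)], of i j]
    by (simp only: s(2) diff_abs_ltwo[OF s(1) s(1), symmetric])
  have L1: "\<exists>N. \<forall>i\<ge>N. \<forall>j\<ge>N. (\<integral>z. norm (s i z - s j z) \<partial>circle_measure) < e" if e: "e > 0" for e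
  proof -
    obtain N where N: "\<And>i j. i \<ge> N \<Longrightarrow> j \<ge> N \<Longrightarrow> norm (X i - X j) < e"
      using CauchyD[OF X e] by blast
    have "(\<integral>z. norm (s i z - s j z) \<partial>circle_measure) \<le> norm (X i - X j)" for i j
      using integral_norm_le_norm_ltwo[OF square_integrable_diff[OF s(1) s(1)], of i j]
      by (simp only: s(2) diff_abs_ltwo[OF s(1) s(1), symmetric])
    with N show ?thesis using order.strict_trans1 by blast
  qed
  obtain r where r: "strict_mono r" "AE z in circle_measure. Cauchy (\<lambda>i. s (r i) z)"
    by (rule cauchy_L1_AE_cauchy_subseq[OF square_integrable_integrable[OF s(1)] L1])
  define f where "f z = lim (\<lambda>i. s (r i) z)" for z
  have meas [measurable]: "s i \<in> borel_measurable circle_measure" for i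
    using s(1) by (auto simp: square_integrable_def)
  have [measurable]: "f \<in> borel_measurable circle_measure"
    unfolding f_def by measurable
  have f: "AE z in circle_measure. (\<lambda>i. s (r i) z) \<longlonglongrightarrow> f z"
    using r(2) by eventually_elim (simp add: f_def Cauchy_convergent_iff convergent_LIMSEQ_iff)
  \<comment> \<open>Fatou's lemma along the subsequence. Integrability is part of the claim because
    one use of it, with \<open>e = 1\<close>, is what shows that \<open>f\<close> itself is square
    integrable.\<close>
  have close: "square_integrable (\<lambda>z. f z - s n z) \<and> norm (abs_ltwo (\<lambda>z. f z - s n z)) \<le> e"
    if e: "e > 0" and N: "\<And>i j. i \<ge> N \<Longrightarrow> j \<ge> N \<Longrightarrow> norm (X i - X j) < e" and n: "n \<ge> N" for e N n
  proof -
    have "(\<integral>\<^sup>+z. ennreal ((cmod (f z - s n z))\<^sup>2) \<partial>circle_measure)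
        = (\<integral>\<^sup>+z. liminf (\<lambda>i. ennreal ((cmod (s (r i) z - s n z))\<^sup>2)) \<partial>circle_measure)"
    proof (rule nn_integral_cong_AE)
      show "AE z in circle_measure. ennreal ((cmod (f z - s n z))\<^sup>2) =
          liminf (\<lambda>i. ennreal ((cmod (s (r i) z - s n z))\<^sup>2))"
        using f
      proof eventually_elim
        case (elim z)
        then have "(\<lambda>i. ennreal ((cmod (s (r i) z - s n z))\<^sup>2)) \<longlonglongrightarrow> ennreal ((cmod (f z - s n z))\<^sup>2)"
          by (intro tendsto_intros)
        then show ?case by (rule lim_imp_Liminf[OF sequentially_bot, symmetric])
      qed
    qed
    also have "\<dots> \<le> liminf (\<lambda>i. \<integral>\<^sup>+z. ennreal ((cmod (s (r i) z - s n z))\<^sup>2) \<partial>circle_measure)"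
      by (rule nn_integral_liminf) simp
    also have "\<dots> \<le> ennreal (e\<^sup>2)"
    proof (rule Liminf_le)
      show "\<forall>\<^sub>F i in sequentially.
          (\<integral>\<^sup>+z. ennreal ((cmod (s (r i) z - s n z))\<^sup>2) \<partial>circle_measure) \<le> ennreal (e\<^sup>2)"
        using eventually_ge_at_top[of N]
      proof eventually_elim
        case (elim i)
        then have i: "r i \<ge> N" using seq_suble[OF r(1), of i] by simp
        have "(\<integral>\<^sup>+z. ennreal ((cmod (s (r i) z - s n z))\<^sup>2) \<partial>circle_measure)
            = ennreal ((norm (X (r i) - X n))\<^sup>2)"
          using square_integrable_diff[OF s(1) s(1), of "r i" n]
          by (subst nn_integral_eq_integral) (auto simp: square_integrable_def dist)
        also have "\<dots> \<le> ennreal (e\<^sup>2)"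
          using N[OF i n] by (intro ennreal_leI power_mono) auto
        finally show ?case .
      qed
    qed simp
    finally have *: "(\<integral>\<^sup>+z. ennreal ((cmod (f z - s n z))\<^sup>2) \<partial>circle_measure) \<le> ennreal (e\<^sup>2)" .
    have int: "integrable circle_measure (\<lambda>z. (cmod (f z - s n z))\<^sup>2)"
      using le_less_trans[OF * ennreal_less_top] by (intro integrableI_bounded) simp_all
    then have sq: "square_integrable (\<lambda>z. f z - s n z)" by (simp add: square_integrable_def)
    have "(norm (abs_ltwo (\<lambda>z. f z - s n z)))\<^sup>2 \<le> e\<^sup>2"
      using * nn_integral_eq_integral[OF int] by (simp add: norm_abs_ltwo[OF sq])
    then show ?thesis using e sq by (simp add: power2_le_iff_abs_le)
  qed
  obtain N where "\<And>i j. i \<ge> N \<Longrightarrow> j \<ge> N \<Longrightarrow> norm (X i - X j) < 1"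
    using CauchyD[OF X, of 1] by auto
  from close[OF zero_less_one this order_refl]
  have sf: "square_integrable f"
    using square_integrable_add[OF _ s(1), of "\<lambda>z. f z - s N z" N] by simp
  have "X \<longlonglongrightarrow> abs_ltwo f"
  proof (rule LIMSEQ_I)
    fix e :: real assume "e > 0"
    then obtain N where N: "\<And>i j. i \<ge> N \<Longrightarrow> j \<ge> N \<Longrightarrow> norm (X i - X j) < e / 2"
      using CauchyD[OF X, of "e / 2"] by auto
    have "norm (X n - abs_ltwo f) < e" if "n \<ge> N" for n
      using close[OF _ N that] \<open>e > 0\<close>
      by (simp add: norm_minus_commute[of "X n"] diff_abs_ltwo[OF sf s(1), symmetric] s(2))
    then show "\<exists>N. \<forall>n\<ge>N. norm (X n - abs_ltwo f) < e" by blast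
  qed
  then show "convergent X" by (auto simp: convergent_def)
qed

section \<open>Closed subspaces and orthogonal projections\<close>

lemma csubspace_diff:
  assumes "csubspace S" "x \<in> S" "y \<in> S"
  shows "x - y \<in> S"
proof -
  have "x + scaleC (-1) y \<in> S" using assms unfolding csubspace_def by blast
  then show ?thesis by (simp add: scaleC_minus_one)
qed

lemma csubspace_add: "csubspace S \<Longrightarrow> x \<in> S \<Longrightarrow> y \<in> S \<Longrightarrow> x + y \<in> S"
  and csubspace_scaleC: "csubspace S \<Longrightarrow> x \<in> S \<Longrightarrow> scaleC c x \<in> S"
  and csubspace_0: "csubspace S \<Longrightarrow> 0 \<in> S"
  unfolding csubspace_def by blast+

lemma csubspace_scaleR: "csubspace S \<Longrightarrow> x \<in> S \<Longrightarrow> r *\<^sub>R x \<in> S"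
  by (metis csubspace_scaleC scaleC_of_real)

lemma csubspace_closure:
  assumes "csubspace S"
  shows "csubspace (closure S)"
  unfolding csubspace_def
proof (intro conjI ballI allI)
  show "0 \<in> closure S" using csubspace_0[OF assms] closure_subset by blast
  fix x assume "x \<in> closure S"
  then obtain X where X: "\<And>n. X n \<in> S" "X \<longlonglongrightarrow> x" by (auto simp: closure_sequential)
  show "scaleC c x \<in> closure S" for c
    using X tendsto_scaleC[OF X(2)] csubspace_scaleC[OF assms] unfolding closure_sequential
    by (intro exI[of _ "\<lambda>n. scaleC c (X n)"]) simp
  fix y assume "y \<in> closure S"
  then obtain Y where Y: "\<And>n. Y n \<in> S" "Y \<longlonglongrightarrow> y" by (auto simp: closure_sequential)
  show "x + y \<in> closure S"
    using X Y tendsto_add[OF X(2) Y(2)] csubspace_add[OF assms] unfolding closure_sequential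
    by (intro exI[of _ "\<lambda>n. X n + Y n"]) simp
qed

text \<open>The form in which the parallelogram law delivers its estimates. It is used for sequences
  minimizing a distance and for sequences maximizing the norm of an image.\<close>

lemma Cauchy_if_square_dist_le:
  fixes x :: "nat \<Rightarrow> 'a::real_normed_vector"
  assumes a: "a \<longlonglongrightarrow> 0" and le: "\<And>m n. (norm (x m - x n))\<^sup>2 \<le> a m + a n"
  shows "Cauchy x"
proof (rule CauchyI)
  fix e :: real assume e: "e > 0"
  then have "\<forall>\<^sub>F n in sequentially. a n < e\<^sup>2 / 2"
    using a by (intro order_tendstoD(2)[where y = 0]) simp_all
  then obtain N where N: "\<And>n. n \<ge> N \<Longrightarrow> a n < e\<^sup>2 / 2"
    by (auto simp: eventually_sequentially)
  have "norm (x m - x n) < e" if "m \<ge> N" "n \<ge> N" for m n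
  proof -
    have "(norm (x m - x n))\<^sup>2 < e\<^sup>2" using le[of m n] N[of m] N[of n] that by simp
    then show ?thesis using e by (simp add: power2_less_imp_less)
  qed
  then show "\<exists>M. \<forall>m\<ge>M. \<forall>n\<ge>M. norm (x m - x n) < e" by blast
qed

text \<open>A sequence in \<open>M\<close> minimizing the distance to \<open>f\<close> is Cauchy,
  since the midpoint of two terms is in \<open>M\<close> and hence no closer than \<open>d\<close>.
  Its limit is a nearest point, and minimality makes the remainder orthogonal to
  \<open>M\<close>.\<close>

lemma orthogonal_decomposition:
  assumes M: "csubspace M" "closed M"
  obtains g where "g \<in> M" "\<And>h. h \<in> M \<Longrightarrow> cinner (f - g) h = 0"
proof -
  define d where "d = infdist f M"
  have ne: "M \<noteq> {}" using csubspace_0[OF M(1)] by blast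
  have d0: "d \<ge> 0" by (simp add: d_def infdist_nonneg)
  have dle: "d \<le> norm (f - h)" if "h \<in> M" for h
    using infdist_le[OF that, of f] by (simp add: d_def dist_norm)
  have "\<exists>g\<in>M. norm (f - g) < d + inverse (real (Suc n))" for n
  proof -
    have "(INF a\<in>M. dist f a) < d + inverse (real (Suc n))"
      using ne by (simp add: d_def infdist_notempty)
    then show ?thesis
      using ne by (subst (asm) cINF_less_iff) (auto simp: dist_norm intro: bdd_belowI2[of _ 0])
  qed
  then obtain G where G: "\<And>n. G n \<in> M" "\<And>n. norm (f - G n) < d + inverse (real (Suc n))"
    by metis
  \<comment> \<open>The law bounds the squared distance of two terms by twice both squared distances
    to \<open>f\<close> minus \<open>4 * d^2\<close>. Half of the subtracted amount is charged to
    each index.\<close>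
  define a where "a n = 2 * ((d + inverse (real (Suc n)))\<^sup>2 - d\<^sup>2)" for n
  have "a \<longlonglongrightarrow> 2 * ((d + 0)\<^sup>2 - d\<^sup>2)"
    unfolding a_def by (intro tendsto_intros LIMSEQ_inverse_real_of_nat)
  then have a: "a \<longlonglongrightarrow> 0" by simp
  have "(norm (G m - G n))\<^sup>2 \<le> a m + a n" for m n
  proof -
    define h where "h = (1 / 2) *\<^sub>R (G m + G n)"
    have "(f - G m) + (f - G n) = 2 *\<^sub>R (f - h)"
      unfolding h_def by (simp add: algebra_simps scaleR_2)
    then have "4 * (norm (f - h))\<^sup>2 + (norm (G n - G m))\<^sup>2 = 2 * (norm (f - G m))\<^sup>2 + 2 * (norm (f - G n))\<^sup>2"
      using parallelogram_law[of "f - G m" "f - G n"] by (simp add: power_mult_distrib)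
    moreover have "d\<^sup>2 \<le> (norm (f - h))\<^sup>2"
      using d0 dle[of h] M(1) G(1)
      by (intro power_mono) (auto simp: h_def csubspace_scaleR csubspace_add)
    moreover have "(norm (f - G i))\<^sup>2 \<le> (d + inverse (real (Suc i)))\<^sup>2" for i
      using G(2)[of i] by (intro power_mono) auto
    from this[of m] this[of n] calculation show ?thesis
      by (simp add: a_def norm_minus_commute)
  qed
  from Cauchy_if_square_dist_le[OF a this] obtain g where g: "G \<longlonglongrightarrow> g"
    using Cauchy_convergent convergent_def by blast
  have gM: "g \<in> M" using closed_sequentially[OF M(2)] G(1) g by blast
  have "norm (f - g) \<le> d + 0"
  proof (rule LIMSEQ_le)
    show "(\<lambda>n. norm (f - G n)) \<longlonglongrightarrow> norm (f - g)" using g by (intro tendsto_intros)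
    show "(\<lambda>n. d + inverse (real (Suc n))) \<longlonglongrightarrow> d + 0"
      by (intro tendsto_intros LIMSEQ_inverse_real_of_nat)
  qed (use G(2) less_imp_le in blast)
  then have min: "norm (f - g) \<le> norm (f - h)" if "h \<in> M" for h using dle[OF that] by simp
  have "cinner (f - g) h = 0" if h: "h \<in> M" for h
  proof (cases "h = 0")
    case False
    \<comment> \<open>The coefficient of the projection of \<open>f - g\<close> onto
      \<open>h\<close>. By Pythagoras, adding this multiple of \<open>h\<close> to \<open>g\<close>
      would shorten the remainder unless it is 0.\<close>
    define c where "c = cinner (f - g) h / (norm h)\<^sup>2"
    have "cinner (f - g - scaleC c h) (scaleC c h) = cnj c * (cinner (f - g) h - c * cinner h h)"
      by (simp only: cinner_scaleC_right cinner_diff_left cinner_scaleC_left)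
    also have "\<dots> = 0" using False by (simp add: c_def cinner_same)
    finally have orth: "cinner (f - (g + scaleC c h)) (scaleC c h) = 0"
      by (simp only: diff_diff_eq)
    have "(norm (f - g))\<^sup>2 = (norm (f - (g + scaleC c h)))\<^sup>2 + (norm (scaleC c h))\<^sup>2"
      using pythagoras_cinner[OF orth] by (simp only: diff_diff_eq[symmetric] diff_add_cancel)
    moreover have "(norm (f - g))\<^sup>2 \<le> (norm (f - (g + scaleC c h)))\<^sup>2"
      using gM h M(1) by (intro power_mono min) (auto simp: csubspace_add csubspace_scaleC)
    ultimately have "norm (scaleC c h) = 0" by simp
    then show ?thesis using False by (simp add: c_def)
  qed simp
  with gM that show ?thesis by blast
qed

text \<open>The definite description denotes the nearest point once uniqueness is known: the
  difference of two candidates is in \<open>S\<close> and orthogonal to itself.\<close>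

lemma
  assumes "csubspace S" "closed S"
  shows orthogonal_projection_in: "orthogonal_projection S f \<in> S"
    and cinner_orthogonal_projection: "h \<in> S \<Longrightarrow> cinner (f - orthogonal_projection S f) h = 0"
proof -
  obtain g where g: "g \<in> S" "\<And>h. h \<in> S \<Longrightarrow> cinner (f - g) h = 0"
    using orthogonal_decomposition[OF assms] by blast
  have "\<exists>!g. g \<in> S \<and> (\<forall>h\<in>S. cinner (f - g) h = 0)"
  proof (rule ex1I)
    show "g \<in> S \<and> (\<forall>h\<in>S. cinner (f - g) h = 0)" using g by blast
    fix g' assume g': "g' \<in> S \<and> (\<forall>h\<in>S. cinner (f - g') h = 0)"
    then have "g' - g \<in> S" using g csubspace_diff[OF assms(1)] by blast
    then have "cinner (f - g) (g' - g) - cinner (f - g') (g' - g) = 0" using g g' by simp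
    then show "g' = g" by (simp add: cinner_diff_left[symmetric] cinner_same)
  qed
  from theI'[OF this]
  show "orthogonal_projection S f \<in> S" "h \<in> S \<Longrightarrow> cinner (f - orthogonal_projection S f) h = 0"
    by (simp_all add: orthogonal_projection_def)
qed

lemma orthogonal_projection_minimal:
  assumes S: "csubspace S" "closed S" and h: "h \<in> S"
  shows "norm (f - orthogonal_projection S f) \<le> norm (f - h)"
proof -
  let ?p = "orthogonal_projection S f"
  have "cinner (f - ?p) (?p - h) = 0"
    by (intro cinner_orthogonal_projection csubspace_diff orthogonal_projection_in S h)
  from pythagoras_cinner[OF this]
  have "(norm (f - ?p))\<^sup>2 \<le> (norm (f - h))\<^sup>2" by simp
  then show ?thesis by (simp add: power2_le_iff_abs_le)
qed

section \<open>Bounded operators on a subspace\<close>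

lemma onorm_on_bound:
  assumes "x \<in> M" "\<And>x. x \<in> M \<Longrightarrow> norm (T x) \<le> K * norm x"
  shows "norm (T x) \<le> onorm_on M T * norm x"
proof (cases "x = 0")
  case False
  \<comment> \<open>The absolute value covers a negative \<open>K\<close>, possible when
    \<open>M\<close> contains only 0. There the quotient is 0 by the convention for division by
    zero.\<close>
  have "norm (T y) / norm y \<le> \<bar>K\<bar>" if "y \<in> M" for y
    using assms(2)[OF that] order_trans[of "norm (T y)" "K * norm y" "\<bar>K\<bar> * norm y"]
    by (cases "y = 0") (auto simp: divide_simps mult_right_mono)
  then have "bdd_above ((\<lambda>x. norm (T x) / norm x) ` M)" by (rule bdd_aboveI2)
  then have "norm (T x) / norm x \<le> onorm_on M T"
    unfolding onorm_on_def by (rule cSUP_upper[OF assms(1)])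
  then show ?thesis using False by (simp add: divide_simps)
qed (use assms in force)

lemma onorm_on_le:
  assumes "M \<noteq> {}" "c \<ge> 0" "\<And>x. x \<in> M \<Longrightarrow> norm (T x) \<le> c * norm x"
  shows "onorm_on M T \<le> c"
  unfolding onorm_on_def
proof (rule cSUP_least[OF assms(1)])
  fix x assume "x \<in> M"
  from assms(3)[OF this] assms(2) show "norm (T x) / norm x \<le> c"
    by (cases "x = 0") (auto simp: divide_simps)
qed

text \<open>Positivity of \<open>K\<close> is a normalization that lets later estimates divide by
  the bound.\<close>

locale bounded_operator_on =
  fixes S :: "ltwo set" and T :: "ltwo \<Rightarrow> ltwo" and K :: real
  assumes csubspace: "csubspace S"
    and T_add: "\<And>x y. x \<in> S \<Longrightarrow> y \<in> S \<Longrightarrow> T (x + y) = T x + T y"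
    and T_scaleC: "\<And>c x. x \<in> S \<Longrightarrow> T (scaleC c x) = scaleC c (T x)"
    and T_bound: "\<And>x. x \<in> S \<Longrightarrow> norm (T x) \<le> K * norm x"
    and K_pos: "K > 0"
begin

lemma T_scaleR: "x \<in> S \<Longrightarrow> T (r *\<^sub>R x) = r *\<^sub>R T x"
  using T_scaleC[of x "of_real r"] by (simp add: scaleC_of_real)

lemma T_diff: "x \<in> S \<Longrightarrow> y \<in> S \<Longrightarrow> T (x - y) = T x - T y"
  using T_add[of "x - y" y] csubspace_diff[OF csubspace] by simp

lemma T_tendsto:
  assumes "\<And>n. X n \<in> S" "x \<in> S" "X \<longlonglongrightarrow> x"
  shows "(\<lambda>n. T (X n)) \<longlonglongrightarrow> T x"
proof -
  have "(\<lambda>n. K * norm (X n - x)) \<longlonglongrightarrow> 0"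
    using assms(3) by (intro tendsto_mult_right_zero tendsto_norm_zero LIM_zero)
  then have "(\<lambda>n. T (X n) - T x) \<longlonglongrightarrow> 0"
    by (rule Lim_null_comparison[rotated])
       (simp add: assms T_diff[symmetric] T_bound csubspace_diff[OF csubspace])
  then show ?thesis by (rule LIM_zero_cancel)
qed

text \<open>If \<open>T x\<close> and \<open>T y\<close> are close to each other and of norm close
  to \<open>s\<close>, then \<open>T (x + y)\<close> has norm close to \<open>2 * s\<close>. This
  forces \<open>norm (x + y)\<close> close to 2, so the unit vectors \<open>x\<close> and
  \<open>y\<close> are close. Compactness is used only to make the images converge.\<close>

lemma norm_attaining_on_if_compact:
  assumes comp: "compact (closure (T ` (S \<inter> cball 0 1)))"
    and M: "csubspace M" "closed M" "M \<subseteq> S" "M \<noteq> {0}"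
  shows "norm_attaining_on M T"
proof -
  define s where "s = onorm_on M T"
  have le: "norm (T x) \<le> s * norm x" if "x \<in> M" for x
    unfolding s_def using that M(3) T_bound by (intro onorm_on_bound) auto
  obtain x0 where x0: "x0 \<in> M" "x0 \<noteq> 0" using M(1,4) csubspace_0 by blast
  define u where "u = (1 / norm x0) *\<^sub>R x0"
  have u: "u \<in> M" "norm u = 1"
    using x0 csubspace_scaleR[OF M(1) x0(1)] by (simp_all add: u_def)
  have s0: "s \<ge> 0" using le[OF u(1)] u(2) by (metis mult.right_neutral norm_ge_zero order_trans)
  show ?thesis
  proof (cases "s = 0")
    case True
    then show ?thesis using le[OF u(1)] u unfolding norm_attaining_on_def s_def[symmetric] by auto
  next
    case False
    then have s: "s > 0" using s0 by simp
    \<comment> \<open>The slack is a fraction of \<open>s\<close>, so the bound stays nonnegative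
      even at \<open>n = 0\<close>, as \<open>onorm_on_le\<close> demands.\<close>
    have "\<exists>x\<in>M. norm x = 1 \<and> norm (T x) > s - s * inverse (real (Suc n))" for n
    proof (rule ccontr)
      assume neg: "\<not> ?thesis"
      have "s \<le> s - s * inverse (real (Suc n))"
      proof (rule onorm_on_le[where M = M and T = T, folded s_def])
        show "M \<noteq> {}" using u by blast
        have "inverse (real (Suc n)) \<le> 1" by (simp add: inverse_eq_divide)
        then show "0 \<le> s - s * inverse (real (Suc n))"
          using s mult_left_mono[of "inverse (real (Suc n))" 1 s] by simp
        fix x assume x: "x \<in> M"
        show "norm (T x) \<le> (s - s * inverse (real (Suc n))) * norm x"
        proof (cases "x = 0")
          case True
          then show ?thesis using le[OF x] by simp
        next
          case x0: False
          have "(1 / norm x) *\<^sub>R x \<in> M" "norm ((1 / norm x) *\<^sub>R x) = 1"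
            using x0 csubspace_scaleR[OF M(1) x] by simp_all
          then have "norm (T ((1 / norm x) *\<^sub>R x)) \<le> s - s * inverse (real (Suc n))"
            using neg by force
          then show ?thesis using x0 x M(3) by (simp add: T_scaleR subset_iff divide_le_eq)
        qed
      qed
      then show False using s by (simp add: mult_le_0_iff)
    qed
    then obtain X where X: "\<And>n. X n \<in> M" "\<And>n. norm (X n) = 1"
      "\<And>n. norm (T (X n)) > s - s * inverse (real (Suc n))" by metis
    have "\<forall>n. T (X n) \<in> closure (T ` (S \<inter> cball 0 1))"
      using X M(3) by (intro allI subsetD[OF closure_subset] imageI) auto
    then obtain r y where r: "strict_mono r" "((\<lambda>n. T (X n)) \<circ> r) \<longlonglongrightarrow> y"
      using spec[OF comp[unfolded compact_eq_seq_compact_metric seq_compact_def], of "\<lambda>n. T (X n)"]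
      by blast
    define x where "x n = X (r n)" for n
    have x: "x n \<in> M" "norm (x n) = 1" "norm (T (x n)) \<le> s" for n
      using X le[of "X (r n)"] by (auto simp: x_def)
    have y: "(\<lambda>n. T (x n)) \<longlonglongrightarrow> y" using r(2) by (simp add: x_def comp_def)
    have lim: "(\<lambda>n. norm (T (X n))) \<longlonglongrightarrow> s"
    proof (rule tendsto_sandwich)
      have "(\<lambda>n. s - s * inverse (real (Suc n))) \<longlonglongrightarrow> s - s * 0"
        by (intro tendsto_intros LIMSEQ_inverse_real_of_nat)
      then show "(\<lambda>n. s - s * inverse (real (Suc n))) \<longlonglongrightarrow> s" by simp
      show "\<forall>\<^sub>F n in sequentially. s - s * inverse (real (Suc n)) \<le> norm (T (X n))"
        using X(3) by (intro always_eventually allI less_imp_le)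
      show "\<forall>\<^sub>F n in sequentially. norm (T (X n)) \<le> s"
        using X(1,2) le by (intro always_eventually allI) (metis mult.right_neutral)
    qed simp
    from LIMSEQ_subseq_LIMSEQ[OF lim r(1)] have lim': "(\<lambda>n. norm (T (x n))) \<longlonglongrightarrow> s"
      by (simp add: x_def comp_def)
    \<comment> \<open>Two defects of the \<open>n\<close>-th vector: how far its image falls short
      of norm \<open>s\<close>, and how far that image is from the limit \<open>y\<close>.\<close>
    define a where "a n = (2 * (s\<^sup>2 - (norm (T (x n)))\<^sup>2) + 2 * (norm (T (x n) - y))\<^sup>2) / s\<^sup>2" for n
    have sq: "(\<lambda>n. (norm (T (x n)))\<^sup>2) \<longlonglongrightarrow> s\<^sup>2" by (rule tendsto_power[OF lim'])
    have "(\<lambda>n. (norm (T (x n) - y))\<^sup>2) \<longlonglongrightarrow> 0\<^sup>2"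
      by (rule tendsto_power[OF tendsto_norm_zero[OF LIM_zero[OF y]]])
    then have "a \<longlonglongrightarrow> (2 * (s\<^sup>2 - s\<^sup>2) + 2 * 0\<^sup>2) / s\<^sup>2"
      unfolding a_def
      by (intro tendsto_divide tendsto_add tendsto_mult tendsto_diff tendsto_const sq) (simp_all add: False)
    then have a: "a \<longlonglongrightarrow> 0" by simp
    have "(norm (x m - x n))\<^sup>2 \<le> a m + a n" for m n
    proof -
      have mem: "x m \<in> S" "x n \<in> S" using x M(3) by auto
      have sum: "(norm (x m + x n))\<^sup>2 = 4 - (norm (x m - x n))\<^sup>2"
        using parallelogram_law[of "x m" "x n"] x(2) by simp
      have "(norm (T (x m) + T (x n)))\<^sup>2 \<le> (s * norm (x m + x n))\<^sup>2"
        using le[OF csubspace_add[OF M(1) x(1) x(1)], of m n] T_add[OF mem]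
        by (intro power_mono) auto
      also have "\<dots> = 4 * s\<^sup>2 - s\<^sup>2 * (norm (x m - x n))\<^sup>2"
        by (simp only: power_mult_distrib sum right_diff_distrib mult.commute)
      finally have "s\<^sup>2 * (norm (x m - x n))\<^sup>2 \<le> 4 * s\<^sup>2 - (norm (T (x m) + T (x n)))\<^sup>2"
        by linarith
      moreover have "(norm (T (x m) - T (x n)))\<^sup>2
          \<le> 2 * (norm (T (x m) - y))\<^sup>2 + 2 * (norm (T (x n) - y))\<^sup>2"
      proof -
        have eq: "(T (x m) - y) - (T (x n) - y) = T (x m) - T (x n)" by simp
        show ?thesis
          using parallelogram_law[of "T (x m) - y" "T (x n) - y", unfolded eq]
            zero_le_power2[of "norm (T (x m) - y + (T (x n) - y))"] by linarith
      qed
      moreover have "s\<^sup>2 * a i = 2 * (s\<^sup>2 - (norm (T (x i)))\<^sup>2) + 2 * (norm (T (x i) - y))\<^sup>2" for i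
        using s by (simp add: a_def)
      from this[of m] this[of n] have "s\<^sup>2 * (a m + a n)
          = 2 * (s\<^sup>2 - (norm (T (x m)))\<^sup>2) + 2 * (norm (T (x m) - y))\<^sup>2
          + (2 * (s\<^sup>2 - (norm (T (x n)))\<^sup>2) + 2 * (norm (T (x n) - y))\<^sup>2)"
        by (simp only: distrib_left)
      moreover note parallelogram_law[of "T (x m)" "T (x n)"]
      ultimately have "s\<^sup>2 * (norm (x m - x n))\<^sup>2 \<le> s\<^sup>2 * (a m + a n)"
        by simp
      then show ?thesis using s by simp
    qed
    from Cauchy_if_square_dist_le[OF a this] obtain z where z: "x \<longlonglongrightarrow> z"
      using Cauchy_convergent convergent_def by blast
    have zM: "z \<in> M" using closed_sequentially[OF M(2)] x(1) z by blast
    have "norm z = 1" using tendsto_norm[OF z] x(2) by (simp add: LIMSEQ_const_iff)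
    moreover have "(\<lambda>n. norm (T (x n))) \<longlonglongrightarrow> norm (T z)"
      using x(1) zM M(3) z by (intro tendsto_norm T_tendsto) auto
    with lim' have "norm (T z) = s" using LIMSEQ_unique by blast
    ultimately show ?thesis using zM unfolding norm_attaining_on_def s_def by blast
  qed
qed

end

lemma bounded_operators_locale:
  assumes "csubspace S" "T \<in> bounded_operators S R"
  obtains K where "bounded_operator_on S T K"
proof -
  obtain K where K: "\<And>x. x \<in> S \<Longrightarrow> norm (T x) \<le> K * norm x"
    using assms by (auto simp: bounded_operators_def)
  have "norm (T x) \<le> (\<bar>K\<bar> + 1) * norm x" if "x \<in> S" for x
    using K[OF that] mult_right_mono[of K "\<bar>K\<bar> + 1" "norm x"] by force
  with assms have "bounded_operator_on S T (\<bar>K\<bar> + 1)"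
    by unfold_locales (auto simp: bounded_operators_def clinear_on_def)
  with that show ?thesis by blast
qed

lemma compact_operators_subset_AN:
  assumes "csubspace S"
  shows "compact_operators S R \<subseteq> AN_operators S R"
proof
  fix T assume T: "T \<in> compact_operators S R"
  then have "T \<in> bounded_operators S R" by (simp add: compact_operators_def)
  with assms obtain K where "bounded_operator_on S T K" by (rule bounded_operators_locale)
  then interpret bounded_operator_on S T K .
  show "T \<in> AN_operators S R"
    using T norm_attaining_on_if_compact by (simp add: compact_operators_def AN_operators_def)
qed

section \<open>Failure of compactness and joint kernels of finitely many functionals\<close>

lemma compact_closure_if_totally_bounded:
  fixes A :: "'a::complete_space set"
  assumes "\<And>e. e > 0 \<Longrightarrow> \<exists>k. finite k \<and> A \<subseteq> (\<Union>x\<in>k. ball x e)"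
  shows "compact (closure A)"
  unfolding compact_eq_totally_bounded complete_eq_closed
proof (intro conjI allI impI)
  fix e :: real assume e: "e > 0"
  obtain k where k: "finite k" "A \<subseteq> (\<Union>x\<in>k. ball x (e / 2))" using assms[of "e / 2"] e by auto
  have "closure A \<subseteq> (\<Union>x\<in>k. cball x (e / 2))"
    using k by (intro closure_minimal closed_UN) (auto simp: subset_iff intro: less_imp_le)
  also have "\<dots> \<subseteq> (\<Union>x\<in>k. ball x e)" using e by (intro UN_mono) auto
  finally show "\<exists>k. finite k \<and> closure A \<subseteq> (\<Union>x\<in>k. ball x e)" using k(1) by blast
qed simp

text \<open>Some radius \<open>e\<close> admits no finite cover by balls, so a point outside the
  balls around all earlier points can always be chosen next.\<close>

lemma separated_sequence_if_not_compact:
  fixes A :: "'a::complete_space set"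
  assumes "\<not> compact (closure A)"
  shows "\<exists>e>0. \<exists>y :: nat \<Rightarrow> 'a. \<forall>n. y n \<in> A \<and> (\<forall>m<n. e \<le> dist (y m) (y n))"
proof -
  obtain e where e: "e > 0" "\<And>k. finite k \<Longrightarrow> \<not> A \<subseteq> (\<Union>x\<in>k. ball x e)"
    using compact_closure_if_totally_bounded[of A] assms by blast
  have "\<exists>y. \<forall>n::nat. y n \<in> A \<and> (\<forall>m<n. e \<le> dist (y m) (y n))"
  proof (rule dependent_wellorder_choice)
    fix n :: nat and y :: "nat \<Rightarrow> 'a"
    have "\<not> A \<subseteq> (\<Union>x\<in>y ` {..<n}. ball x e)" by (intro e) simp
    then show "\<exists>r. r \<in> A \<and> (\<forall>m<n. e \<le> dist (y m) r)" by (auto simp: not_less)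
  qed simp
  with e(1) show ?thesis by blast
qed

lemma simultaneously_convergent_subsequence:
  fixes c :: "'i \<Rightarrow> nat \<Rightarrow> 'a::heine_borel"
  assumes "finite I" "\<And>i. i \<in> I \<Longrightarrow> bounded (range (c i))"
  shows "\<exists>r::nat \<Rightarrow> nat. strict_mono r \<and> (\<forall>i\<in>I. convergent (c i \<circ> r))"
  using assms
proof (induction I)
  case empty
  show ?case by (auto intro: exI[of _ id] strict_mono_id)
next
  case (insert i I)
  have "\<exists>r. strict_mono r \<and> (\<forall>i\<in>I. convergent (c i \<circ> r))"
    by (intro insert.IH insert.prems) simp
  then obtain r where r: "strict_mono r" "\<And>j. j \<in> I \<Longrightarrow> convergent (c j \<circ> r)" by blast
  have "bounded (range (c i \<circ> r))" using insert.prems by (rule bounded_subset) auto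
  then obtain l q where q: "strict_mono q" "((c i \<circ> r) \<circ> q) \<longlonglongrightarrow> l"
    using bounded_imp_convergent_subsequence by blast
  have "convergent (c j \<circ> (r \<circ> q))" if "j \<in> insert i I" for j
  proof (cases "j = i")
    case True
    then show ?thesis using q(2) unfolding convergent_def comp_assoc by blast
  next
    case False
    with that have "convergent ((c j \<circ> r) \<circ> q)"
      by (intro convergent_subseq_convergent r(2) q(1)) simp
    then show ?thesis by (simp only: comp_assoc)
  qed
  then show ?case using strict_mono_o[OF r(1) q(1)] by blast
qed

text \<open>The joint kernel has finite codimension, and on a finite-dimensional quotient the
  functionals control the quotient norm. The induction makes this explicit without assuming
  independence: a new functional either vanishes already on the joint kernel of the others, or is
  corrected along a vector \<open>u\<close> on which only it is nonzero.\<close>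

lemma approximate_by_joint_kernel:
  fixes l :: "'i \<Rightarrow> ltwo \<Rightarrow> complex"
  assumes S: "csubspace S" and I: "finite I"
    and add: "\<And>i x y. i \<in> I \<Longrightarrow> x \<in> S \<Longrightarrow> y \<in> S \<Longrightarrow> l i (x + y) = l i x + l i y"
    and scale: "\<And>i c x. i \<in> I \<Longrightarrow> x \<in> S \<Longrightarrow> l i (scaleC c x) = c * l i x"
    and bd: "\<And>i x. i \<in> I \<Longrightarrow> x \<in> S \<Longrightarrow> cmod (l i x) \<le> B i * norm x"
  shows "\<exists>C\<ge>0. \<forall>w\<in>S. \<exists>v\<in>S. (\<forall>i\<in>I. l i v = 0) \<and> norm (w - v) \<le> C * (\<Sum>i\<in>I. cmod (l i w))"
  using I add scale bd
proof (induction I)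
  case empty
  show ?case by (intro exI[of _ 0]) auto
next
  case (insert i I)
  have "\<exists>C\<ge>0. \<forall>w\<in>S. \<exists>v\<in>S. (\<forall>j\<in>I. l j v = 0) \<and> norm (w - v) \<le> C * (\<Sum>j\<in>I. cmod (l j w))"
    by (rule insert.IH) (rule insert.prems; simp)+
  then obtain C where C: "C \<ge> 0"
    "\<And>w. w \<in> S \<Longrightarrow> \<exists>v\<in>S. (\<forall>j\<in>I. l j v = 0) \<and> norm (w - v) \<le> C * (\<Sum>j\<in>I. cmod (l j w))"
    by blast
  have diff: "l j (x - y) = l j x - l j y" if "j \<in> insert i I" "x \<in> S" "y \<in> S" for j x y
    using insert.prems(1)[OF that(1) csubspace_diff[OF S that(2,3)] that(3)] by simp
  show ?case
  proof (cases "\<forall>v\<in>S. (\<forall>j\<in>I. l j v = 0) \<longrightarrow> l i v = 0")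
    case True
    have "\<exists>v\<in>S. (\<forall>j\<in>insert i I. l j v = 0) \<and> norm (w - v) \<le> C * (\<Sum>j\<in>insert i I. cmod (l j w))"
      if w: "w \<in> S" for w
    proof -
      obtain v where v: "v \<in> S" "\<forall>j\<in>I. l j v = 0" "norm (w - v) \<le> C * (\<Sum>j\<in>I. cmod (l j w))"
        using C(2)[OF w] by blast
      moreover have "C * (\<Sum>j\<in>I. cmod (l j w)) \<le> C * (\<Sum>j\<in>insert i I. cmod (l j w))"
        using C(1) insert.hyps by (intro mult_left_mono) auto
      ultimately show ?thesis using True by (intro bexI[of _ v]) auto
    qed
    then show ?thesis using C(1) by blast
  next
    case False
    then obtain u where u: "u \<in> S" "\<forall>j\<in>I. l j u = 0" "l i u \<noteq> 0" by blast
    \<comment> \<open>\<open>C\<close> pays for reaching the kernel of the old functionals. The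
      second summand pays for the move along \<open>u\<close>, whose coefficient is governed by
      \<open>l i v\<close>, that is by \<open>l i w\<close> and the error
      \<open>w - v\<close>.\<close>
    define D where "D = C + norm u / cmod (l i u) * (1 + \<bar>B i\<bar> * C)"
    have D: "D \<ge> 0" using C(1) by (simp add: D_def)
    have "\<exists>v\<in>S. (\<forall>j\<in>insert i I. l j v = 0) \<and> norm (w - v) \<le> D * (\<Sum>j\<in>insert i I. cmod (l j w))"
      if w: "w \<in> S" for w
    proof -
      define s where "s = (\<Sum>j\<in>I. cmod (l j w))"
      define s' where "s' = (\<Sum>j\<in>insert i I. cmod (l j w))"
      have s': "s' = cmod (l i w) + s" using insert.hyps by (simp add: s_def s'_def)
      have s0: "s \<ge> 0" by (simp add: s_def sum_nonneg)
      obtain v where v: "v \<in> S" "\<forall>j\<in>I. l j v = 0" "norm (w - v) \<le> C * s"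
        using C(2)[OF w] unfolding s_def by blast
      define c where "c = l i v / l i u"
      have uS: "scaleC c u \<in> S" by (rule csubspace_scaleC[OF S u(1)])
      have "l j (v - scaleC c u) = 0" if j: "j \<in> insert i I" for j
        using diff[OF j v(1) uS] insert.prems(2)[OF j u(1), of c] u v j by (auto simp: c_def)
      moreover have "norm (w - (v - scaleC c u)) \<le> D * s'"
      proof -
        have "l i v = l i w - l i (w - v)" using diff[of i w v] w v by simp
        then have "cmod (l i v) \<le> cmod (l i w) + cmod (l i (w - v))"
          by (simp add: norm_triangle_ineq4)
        also have "cmod (l i (w - v)) \<le> B i * norm (w - v)"
          using insert.prems(3) csubspace_diff[OF S w v(1)] by simp
        also have "\<dots> \<le> \<bar>B i\<bar> * norm (w - v)"
          by (intro mult_right_mono) auto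
        also have "\<dots> \<le> \<bar>B i\<bar> * (C * s)" using v(3) by (intro mult_left_mono) auto
        also have "\<dots> \<le> \<bar>B i\<bar> * (C * s')"
          using C(1) s' by (intro mult_left_mono) auto
        also have "cmod (l i w) \<le> s'" using s' s0 by simp
        finally have "cmod (l i v) \<le> (1 + \<bar>B i\<bar> * C) * s'" by (simp add: algebra_simps)
        then have "cmod c \<le> (1 + \<bar>B i\<bar> * C) * s' / cmod (l i u)"
          by (simp add: c_def norm_divide divide_right_mono)
        from mult_right_mono[OF this norm_ge_zero[of u]]
        have "cmod c * norm u \<le> norm u / cmod (l i u) * (1 + \<bar>B i\<bar> * C) * s'"
          by (simp add: mult_ac)
        moreover have "C * s \<le> C * s'" using C(1) s' by (intro mult_left_mono) auto
        moreover have "norm (w - (v - scaleC c u)) \<le> norm (w - v) + cmod c * norm u"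
          using norm_triangle_ineq[of "w - v" "scaleC c u"] by (simp add: algebra_simps)
        ultimately show ?thesis using v(3) by (simp add: D_def distrib_right)
      qed
      ultimately show ?thesis using csubspace_diff[OF S v(1) uS] unfolding s'_def by blast
    qed
    with D show ?thesis by blast
  qed
qed

section \<open>From absolute norm attainment to compactness\<close>

context bounded_operator_on
begin

text \<open>The intermediate value theorem on the segment from \<open>u\<close> to \<open>v\<close>,
  followed by normalization. Only the ratio of the two norms matters, so the end points need not be
  unit vectors.\<close>

lemma unit_vector_with_norm_image:
  assumes N: "csubspace N" "N \<subseteq> S" and u: "u \<in> N" "norm (T u) < c * norm u"
    and v: "v \<in> N" "norm (T v) > c * norm v"
  shows "\<exists>g\<in>N. norm g = 1 \<and> norm (T g) = c"
proof -
  define p where "p t = (1 - t) *\<^sub>R u + t *\<^sub>R v" for t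
  have uS: "u \<in> S" "v \<in> S" using N u v by auto
  have pN: "p t \<in> N" for t
    unfolding p_def by (intro csubspace_add csubspace_scaleR N u v)
  have Tp: "T (p t) = (1 - t) *\<^sub>R T u + t *\<^sub>R T v" for t
    unfolding p_def by (simp add: T_add T_scaleR uS csubspace_scaleR[OF csubspace])
  define F where "F t = norm (T (p t)) - c * norm (p t)" for t
  have "continuous_on {0..1} F"
    unfolding F_def Tp unfolding p_def by (intro continuous_intros)
  moreover have "F 0 \<le> 0" "0 \<le> F 1" using u v by (auto simp: F_def p_def)
  ultimately obtain t where t: "0 \<le> t" "t \<le> 1" "F t = 0"
    using IVT'[of F 0 0 1] by auto
  \<comment> \<open>At a zero of the segment, \<open>u\<close> and \<open>v\<close> are balanced
    with weights \<open>1 - t\<close> and \<open>t\<close>, and so are their images. The strict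
    inequalities in opposite directions would then force both weights to vanish.\<close>
  have "p t \<noteq> 0"
  proof
    assume p0: "p t = 0"
    then have "T (p t) = 0" using T_scaleC[of 0 0] csubspace_0[OF csubspace] by simp
    then have "norm ((1 - t) *\<^sub>R T u) = norm (t *\<^sub>R T v)"
      unfolding Tp by (metis eq_neg_iff_add_eq_0 norm_minus_cancel)
    then have 1: "(1 - t) * norm (T u) = t * norm (T v)" using t by simp
    have "norm ((1 - t) *\<^sub>R u) = norm (t *\<^sub>R v)"
      using p0 unfolding p_def by (metis eq_neg_iff_add_eq_0 norm_minus_cancel)
    then have 2: "(1 - t) * norm u = t * norm v" using t by simp
    have "(1 - t) * norm (T u) \<le> (1 - t) * (c * norm u)" "t * (c * norm v) \<le> t * norm (T v)"
      using t u v by (auto intro!: mult_left_mono)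
    moreover have "(1 - t) * (c * norm u) = t * (c * norm v)"
      using 2 by (metis mult.left_commute)
    ultimately have "(1 - t) * norm (T u) = (1 - t) * (c * norm u)"
      "t * (c * norm v) = t * norm (T v)" using 1 by linarith+
    then have "1 - t = 0" "t = 0" using u(2) v(2) by auto
    then show False by simp
  qed
  moreover have "norm (T (p t)) = c * norm (p t)" using t(3) by (simp add: F_def)
  ultimately show ?thesis
    using pN[of t] N
    by (intro bexI[of _ "(1 / norm (p t)) *\<^sub>R p t"]) (auto simp: T_scaleR csubspace_scaleR subset_iff)
qed

text \<open>\<beta> does not depend on \<open>A\<close>, and this is what allows an infinite
  recursion in which \<open>A\<close> collects the vectors found so far. The sequence
  \<open>e\<close> provides ratios below \<open>c\<close>, and differences of a separated sequence
  of images provide ratios above it.\<close>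

lemma unit_vectors_with_prescribed_norms:
  assumes ncomp: "\<not> compact (closure (T ` (S \<inter> cball 0 1)))"
    and e: "\<And>n. e n \<in> S" "\<And>n. norm (e n) = 1" "\<And>g. (\<lambda>n. cinner (e n) g) \<longlonglongrightarrow> 0"
      "(\<lambda>n. T (e n)) \<longlonglongrightarrow> 0"
  obtains \<beta> where "\<beta> > 0"
    "\<And>A c. finite A \<Longrightarrow> 0 < c \<Longrightarrow> c < \<beta> \<Longrightarrow> \<exists>g\<in>S. norm g = 1 \<and> norm (T g) = c \<and>
      (\<forall>a\<in>A. cinner g a = 0 \<and> cinner (T g) (T a) = 0)"
proof -
  obtain d and y :: "nat \<Rightarrow> ltwo" where d: "d > 0" "\<And>n. y n \<in> T ` (S \<inter> cball 0 1)" "\<And>m n. m < n \<Longrightarrow> d \<le> dist (y m) (y n)"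
    using separated_sequence_if_not_compact[OF ncomp] by blast
  have "\<exists>x. x \<in> S \<and> norm x \<le> 1 \<and> y n = T x" for n using d(2)[of n] by auto
  then obtain x where x: "\<And>n. x n \<in> S" "\<And>n. norm (x n) \<le> 1" "\<And>n. y n = T (x n)" by metis
  have "\<exists>g\<in>S. norm g = 1 \<and> norm (T g) = c \<and> (\<forall>a\<in>A. cinner g a = 0 \<and> cinner (T g) (T a) = 0)"
    if A: "finite A" and c: "0 < c" "c < d / 8" for A c
  proof -
    \<comment> \<open>Each \<open>a\<close> contributes two functionals: the tag \<open>True\<close>
      tests orthogonality to \<open>a\<close>, and \<open>False\<close> tests orthogonality of the
      images.\<close>
    define l where "l = (\<lambda>(b, a) x. if b then cinner x a else cinner (T x) (T a))"
    define B where "B = (\<lambda>(b, a). if b then norm a else K * norm (T a))"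
    define I where "I = (UNIV :: bool set) \<times> A"
    have I: "finite I" using A by (simp add: I_def)
    have l_add: "l i (x + y) = l i x + l i y" if "x \<in> S" "y \<in> S" for i x y
      using that by (cases i) (simp add: l_def cinner_add_left T_add)
    have l_scale: "l i (scaleC c x) = c * l i x" if "x \<in> S" for i c x
      using that by (cases i) (simp add: l_def cinner_scaleC_left T_scaleC)
    have l_bound: "cmod (l i x) \<le> B i * norm x" if "x \<in> S" for i x
    proof -
      have "cmod (cinner (T x) (T a)) \<le> K * norm (T a) * norm x" for a
        using order_trans[OF cinner_Cauchy_Schwarz mult_right_mono[OF T_bound[OF that] norm_ge_zero[of "T a"]]]
        by (simp add: mult_ac)
      moreover have "cmod (cinner x a) \<le> norm a * norm x" for a
        using cinner_Cauchy_Schwarz[of x a] by (simp add: mult.commute)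
      ultimately show ?thesis by (cases i) (simp add: l_def B_def)
    qed
    define N where "N = {v\<in>S. \<forall>i\<in>I. l i v = 0}"
    have l_zero: "l i 0 = 0" for i using l_scale[of 0 i 0] csubspace_0[OF csubspace] by simp
    have N: "csubspace N" "N \<subseteq> S"
      unfolding csubspace_def N_def
      using csubspace_0[OF csubspace] csubspace_add[OF csubspace] csubspace_scaleC[OF csubspace]
      by (auto simp: l_zero l_add l_scale)
    have "\<exists>C\<ge>0. \<forall>w\<in>S. \<exists>v\<in>S. (\<forall>i\<in>I. l i v = 0) \<and> norm (w - v) \<le> C * (\<Sum>i\<in>I. cmod (l i w))"
      by (rule approximate_by_joint_kernel[OF csubspace I, where B = B])
         (rule l_add l_scale l_bound; assumption)+
    then obtain C where C: "C \<ge> 0"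
      "\<And>w. w \<in> S \<Longrightarrow> \<exists>v\<in>N. norm (w - v) \<le> C * (\<Sum>i\<in>I. cmod (l i w))"
      unfolding N_def by blast
    have approx: "\<exists>\<eta>>0. \<forall>w\<in>S. (\<forall>i\<in>I. cmod (l i w) < \<eta>) \<longrightarrow> (\<exists>v\<in>N. norm (w - v) \<le> \<epsilon>)"
      if "\<epsilon> > 0" for \<epsilon>
    proof (intro exI conjI ballI impI)
      \<comment> \<open>The added ones keep the divisor positive when \<open>C\<close> is 0 or
        \<open>A\<close> is empty.\<close>
      let ?m = "(C + 1) * (real (card I) + 1)"
      have m: "?m > 0" using C(1) by simp
      show "\<epsilon> / ?m > 0" using that m by simp
      fix w assume w: "w \<in> S" "\<forall>i\<in>I. cmod (l i w) < \<epsilon> / ?m"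
      obtain v where v: "v \<in> N" "norm (w - v) \<le> C * (\<Sum>i\<in>I. cmod (l i w))"
        using C(2)[OF w(1)] by blast
      have q: "0 \<le> \<epsilon> / ?m" using that m by simp
      have "(\<Sum>i\<in>I. cmod (l i w)) \<le> real (card I) * (\<epsilon> / ?m)"
        using w(2) by (intro sum_bounded_above) auto
      also have "\<dots> \<le> (real (card I) + 1) * (\<epsilon> / ?m)"
        using q by (intro mult_right_mono) simp_all
      finally have "C * (\<Sum>i\<in>I. cmod (l i w)) \<le> C * ((real (card I) + 1) * (\<epsilon> / ?m))"
        using C(1) by (rule mult_left_mono)
      also have "\<dots> \<le> (C + 1) * ((real (card I) + 1) * (\<epsilon> / ?m))"
        using q by (intro mult_right_mono mult_nonneg_nonneg) simp_all
      also have "\<dots> = \<epsilon>" using m by (simp only: mult.assoc[symmetric] nonzero_mult_div_cancel_left times_divide_eq_right)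
      finally have "norm (w - v) \<le> \<epsilon>" using v(2) by (rule order_trans[rotated])
      with v(1) show "\<exists>v\<in>N. norm (w - v) \<le> \<epsilon>" by blast
    qed
    have "\<exists>u\<in>N. norm (T u) < c * norm u"
    proof -
      \<comment> \<open>Moving the unit vector \<open>e n\<close> by at most \<open>1 / 2\<close>
        leaves norm at least \<open>1 / 2\<close>. The image changes by at most
        \<open>c / 8\<close>, so its norm stays below \<open>c / 4\<close>, short of
        \<open>c * norm v\<close>.\<close>
      define \<epsilon> where "\<epsilon> = min (1 / 2) (c / (8 * K))"
      have eps: "\<epsilon> > 0" "\<epsilon> \<le> 1 / 2" "K * \<epsilon> \<le> c / 8"
        using c K_pos by (auto simp: \<epsilon>_def min_def field_simps)
      obtain \<eta> where \<eta>: "\<eta> > 0" "\<And>w. w \<in> S \<Longrightarrow> \<forall>i\<in>I. cmod (l i w) < \<eta> \<Longrightarrow> \<exists>v\<in>N. norm (w - v) \<le> \<epsilon>"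
        using approx[OF eps(1)] by blast
      have lim: "(\<lambda>n. l i (e n)) \<longlonglongrightarrow> 0" for i
        using e(3) tendsto_cinner_left[OF e(4)] by (cases i; cases "fst i") (auto simp: l_def)
      have "\<forall>i\<in>I. \<forall>\<^sub>F n in sequentially. cmod (l i (e n)) < \<eta>"
        using order_tendstoD(2)[OF tendsto_norm_zero[OF lim] \<eta>(1)] by blast
      then have "\<forall>\<^sub>F n in sequentially. \<forall>i\<in>I. cmod (l i (e n)) < \<eta>"
        by (rule eventually_ball_finite[OF I])
      moreover have "\<forall>\<^sub>F n in sequentially. norm (T (e n)) < c / 8"
        using order_tendstoD(2)[OF tendsto_norm_zero[OF e(4)], of "c / 8"] c by simp
      ultimately have "\<forall>\<^sub>F n in sequentially. (\<forall>i\<in>I. cmod (l i (e n)) < \<eta>) \<and> norm (T (e n)) < c / 8"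
        by (rule eventually_conj)
      then obtain n where n: "\<forall>i\<in>I. cmod (l i (e n)) < \<eta>" "norm (T (e n)) < c / 8"
        using eventually_happens' sequentially_bot by blast
      obtain v where v: "v \<in> N" "norm (e n - v) \<le> \<epsilon>" using \<eta>(2)[OF e(1) n(1)] by blast
      have vS: "v \<in> S" using v N by auto
      have "1 / 2 \<le> norm v"
        using norm_triangle_ineq2[of "e n" v] v(2) eps(2) e(2)[of n] by simp
      then have "c * (1 / 2) \<le> c * norm v" using c by (intro mult_left_mono) simp_all
      moreover have "norm (T v) < c / 4"
      proof -
        have "norm (T (e n - v)) \<le> K * norm (e n - v)"
          by (intro T_bound csubspace_diff[OF csubspace] e(1) vS)
        also have "\<dots> \<le> K * \<epsilon>" using v(2) K_pos by simp
        finally have "norm (T (e n) - T v) \<le> c / 8" using eps(3) by (simp add: T_diff e(1) vS)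
        then show ?thesis using norm_triangle_ineq3[of "T (e n)" "T v"] n(2) by simp
      qed
      ultimately have "norm (T v) < c * norm v"
        using c by linarith
      with v(1) show ?thesis by blast
    qed
    moreover have "\<exists>v\<in>N. norm (T v) > c * norm v"
    proof -
      \<comment> \<open>The difference \<open>w\<close> below has norm at most 2 and image at least
        \<open>d\<close>. After the correction, \<open>norm v \<le> 3\<close> and
        \<open>norm (T v) \<ge> d / 2\<close>, which exceeds \<open>3 * c\<close> because
        \<open>c < d / 8\<close>.\<close>
      define \<epsilon> where "\<epsilon> = min 1 (d / (2 * K))"
      have eps: "\<epsilon> > 0" "\<epsilon> \<le> 1" "K * \<epsilon> \<le> d / 2"
        using d K_pos by (auto simp: \<epsilon>_def min_def field_simps)
      obtain \<eta> where \<eta>: "\<eta> > 0" "\<And>w. w \<in> S \<Longrightarrow> \<forall>i\<in>I. cmod (l i w) < \<eta> \<Longrightarrow> \<exists>v\<in>N. norm (w - v) \<le> \<epsilon>"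
        using approx[OF eps(1)] by blast
      \<comment> \<open>The functionals need not be small on the \<open>x n\<close>. Their values
        are bounded, so they converge along a subsequence and tend to 0 on consecutive differences,
        while the images of these differences keep norm at least \<open>d\<close>.\<close>
      have "bounded (range (\<lambda>n. l i (x n)))" for i
        unfolding bounded_iff
      proof (intro exI ballI)
        fix z assume "z \<in> range (\<lambda>n. l i (x n))"
        then obtain n where n: "z = l i (x n)" by blast
        have "B i \<ge> 0" using K_pos by (simp add: B_def split: prod.split)
        then show "norm z \<le> B i * 1"
          using l_bound[OF x(1), of i n] mult_left_mono[OF x(2), of "B i" n] by (simp add: n)
      qed
      then obtain r :: "nat \<Rightarrow> nat" where r: "strict_mono r"
        "\<And>i. i \<in> I \<Longrightarrow> convergent ((\<lambda>n. l i (x n)) \<circ> r)"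
        using simultaneously_convergent_subsequence[OF I, of "\<lambda>i n. l i (x n)"] by blast
      have "\<forall>\<^sub>F n in sequentially. cmod (l i (x (r n) - x (r (Suc n)))) < \<eta>" if i: "i \<in> I" for i
      proof -
        obtain a where a: "(\<lambda>n. l i (x (r n))) \<longlonglongrightarrow> a"
          using r(2)[OF i] by (auto simp: convergent_def comp_def)
        have "(\<lambda>n. l i (x (r n)) - l i (x (r (Suc n)))) \<longlonglongrightarrow> a - a"
          by (intro tendsto_diff a LIMSEQ_Suc)
        moreover have "l i (x (r n)) - l i (x (r (Suc n))) = l i (x (r n) - x (r (Suc n)))" for n
          using l_add[OF csubspace_diff[OF csubspace x(1) x(1)] x(1), of i "r n" "r (Suc n)" "r (Suc n)"]
          by simp
        ultimately have "(\<lambda>n. l i (x (r n) - x (r (Suc n)))) \<longlonglongrightarrow> 0" by simp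
        from order_tendstoD(2)[OF tendsto_norm_zero[OF this] \<eta>(1)] show ?thesis .
      qed
      then have "\<forall>\<^sub>F n in sequentially. \<forall>i\<in>I. cmod (l i (x (r n) - x (r (Suc n)))) < \<eta>"
        by (intro eventually_ball_finite[OF I]) blast
      then obtain n where n: "\<forall>i\<in>I. cmod (l i (x (r n) - x (r (Suc n)))) < \<eta>"
        using eventually_happens' sequentially_bot by blast
      define w where "w = x (r n) - x (r (Suc n))"
      have wS: "w \<in> S" unfolding w_def by (intro csubspace_diff csubspace x)
      obtain v where v: "v \<in> N" "norm (w - v) \<le> \<epsilon>" using \<eta>(2)[OF wS] n unfolding w_def by blast
      have vS: "v \<in> S" using v N by auto
      have "norm w \<le> 2"
        unfolding w_def using norm_triangle_ineq4[of "x (r n)" "x (r (Suc n))"] x(2)[of "r n"] x(2)[of "r (Suc n)"]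
        by simp
      then have "norm v \<le> 3"
        using norm_triangle_ineq3[of w v] v(2) eps(2) by simp
      then have "c * norm v \<le> c * 3" using c by (intro mult_left_mono) simp_all
      moreover have "norm (T v) \<ge> d / 2"
      proof -
        have "d \<le> norm (T w)"
          using d(3)[OF strict_monoD[OF r(1) lessI], of n] by (simp add: x(3) dist_norm w_def T_diff x(1))
        moreover have "norm (T (w - v)) \<le> K * norm (w - v)"
          by (intro T_bound csubspace_diff[OF csubspace] wS vS)
        moreover have "K * norm (w - v) \<le> K * \<epsilon>" using v(2) K_pos by simp
        ultimately show ?thesis
          using eps(3) norm_triangle_ineq2[of "T w" "T v"] by (simp add: T_diff wS vS)
      qed
      ultimately have "c * norm v < norm (T v)"
        using c d(1) by linarith
      with v(1) show ?thesis by blast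
    qed
    ultimately obtain g where g: "g \<in> N" "norm g = 1" "norm (T g) = c"
      using unit_vector_with_norm_image[OF N] by blast
    have "cinner g a = 0 \<and> cinner (T g) (T a) = 0" if "a \<in> A" for a
    proof -
      have "l (True, a) g = 0" "l (False, a) g = 0" using g(1) that by (auto simp: N_def I_def)
      then show ?thesis by (simp add: l_def)
    qed
    with g N show ?thesis by blast
  qed
  moreover have "d / 8 > 0" using d(1) by simp
  ultimately show ?thesis by (rule that[rotated])
qed

lemma compact_if_norm_attaining_on:
  assumes S: "closed S"
    and e: "\<And>n. e n \<in> S" "\<And>n. norm (e n) = 1" "\<And>g. (\<lambda>n. cinner (e n) g) \<longlonglongrightarrow> 0"
      "(\<lambda>n. T (e n)) \<longlonglongrightarrow> 0"
    and AN: "\<And>M. csubspace M \<Longrightarrow> closed M \<Longrightarrow> M \<subseteq> S \<Longrightarrow> M \<noteq> {0} \<Longrightarrow> norm_attaining_on M T"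
  shows "compact (closure (T ` (S \<inter> cball 0 1)))"
proof (rule ccontr)
  assume "\<not> ?thesis"
  from unit_vectors_with_prescribed_norms[OF this e]
  obtain \<beta> where \<beta>: "\<beta> > 0"
    "\<And>A c. finite A \<Longrightarrow> 0 < c \<Longrightarrow> c < \<beta> \<Longrightarrow> \<exists>g\<in>S. norm g = 1 \<and> norm (T g) = c \<and>
      (\<forall>a\<in>A. cinner g a = 0 \<and> cinner (T g) (T a) = 0)"
    by blast
  \<comment> \<open>Strictly increasing to \<beta>. The shift by two makes the first value
    \<open>\<beta> / 2\<close>, so that every value is positive.\<close>
  define c where "c k = \<beta> - \<beta> * inverse (real (Suc (Suc k)))" for k
  have c: "0 < c k" "c k < \<beta>" for k
  proof -
    have "inverse (real (Suc (Suc k))) < 1" "0 < inverse (real (Suc (Suc k)))"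
      by (simp_all add: inverse_eq_divide)
    from mult_strict_left_mono[OF this(1) \<beta>(1)] mult_pos_pos[OF \<beta>(1) this(2)]
    show "0 < c k" "c k < \<beta>" by (simp_all add: c_def)
  qed
  have "\<exists>g. \<forall>k::nat. g k \<in> S \<and> norm (g k) = 1 \<and> norm (T (g k)) = c k \<and>
      (\<forall>j<k. cinner (g k) (g j) = 0 \<and> cinner (T (g k)) (T (g j)) = 0)"
  proof (rule dependent_wellorder_choice)
    fix k :: nat and g :: "nat \<Rightarrow> ltwo"
    show "\<exists>r. r \<in> S \<and> norm r = 1 \<and> norm (T r) = c k \<and>
        (\<forall>j<k. cinner r (g j) = 0 \<and> cinner (T r) (T (g j)) = 0)"
      using \<beta>(2)[of "g ` {..<k}", OF _ c, of k] by (auto simp: Bex_def)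
  qed simp
  then obtain g where g: "\<And>k. g k \<in> S" "\<And>k. norm (g k) = 1" "\<And>k. norm (T (g k)) = c k"
    "\<And>j k. j < k \<Longrightarrow> cinner (g k) (g j) = 0"
    "\<And>j k. j < k \<Longrightarrow> cinner (T (g k)) (T (g j)) = 0"
    by blast
  define D where "D = {\<Sum>k<n. scaleC (a k) (g k) | a n. True}"
  have DS: "(\<Sum>k<n. scaleC (a k) (g k)) \<in> S" for a and n :: nat
    by (induction n) (auto simp: g csubspace_0[OF csubspace] csubspace_add[OF csubspace] csubspace_scaleC[OF csubspace])
  have D_intro: "(\<Sum>k<n. scaleC (a k) (g k)) \<in> D" for a n
    unfolding D_def by blast
  have D: "csubspace D"
    unfolding csubspace_def
  proof (intro conjI ballI allI)
    show "0 \<in> D" by (auto simp: D_def intro!: exI[of _ "0::nat"])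
    fix x assume "x \<in> D"
    then obtain a n where x: "x = (\<Sum>k<n. scaleC (a k) (g k))" by (auto simp: D_def)
    have "scaleC b x = (\<Sum>k<n. scaleC (b * a k) (g k))" for b
      unfolding x by (induction n) (simp_all add: scaleC_add_right scaleC_scaleC)
    then show "scaleC b x \<in> D" for b using D_intro by simp
    fix y assume "y \<in> D"
    then obtain b m where y: "y = (\<Sum>k<m. scaleC (b k) (g k))" by (auto simp: D_def)
    \<comment> \<open>Zero coefficients bring two combinations to a common length.\<close>
    have pad: "(\<Sum>k<n. scaleC (a k) (g k)) = (\<Sum>k<N. scaleC (if k < n then a k else 0) (g k))"
      if "n \<le> N" for a n and N :: nat
      using that by (intro sum.mono_neutral_cong_left) auto
    have "x + y = (\<Sum>k<max n m. scaleC ((if k < n then a k else 0) + (if k < m then b k else 0)) (g k))"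
      unfolding x y pad[of n "max n m" a, OF max.cobounded1] pad[of m "max n m" b, OF max.cobounded2]
        scaleC_add_left sum.distrib ..
    then show "x + y \<in> D" using D_intro by simp
  qed
  \<comment> \<open>For a finite combination with coefficients \<open>a k\<close>, orthogonality of
    the \<open>g k\<close> and of their images makes the right side the sum of
    \<open>(\<beta>^2 - (c k)^2) * (cmod (a k))^2\<close>. All terms are nonnegative, and the left
    side is the term for \<open>j\<close>, or 0 if \<open>g j\<close> does not occur. In this form
    the estimate passes to the closure without any infinite expansion.\<close>
  have gap: "(\<beta>\<^sup>2 - (c j)\<^sup>2) * (cmod (cinner x (g j)))\<^sup>2 \<le> \<beta>\<^sup>2 * (norm x)\<^sup>2 - (norm (T x))\<^sup>2"
    if xD: "x \<in> D" for x j
  proof -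
    obtain a n where x: "x = (\<Sum>k<n. scaleC (a k) (g k))" using xD by (auto simp: D_def)
    let ?s = "\<lambda>n. \<Sum>k<n. scaleC (a k) (g k)"
    have orth: "cinner (?s n) (g j) = 0 \<and> cinner (T (?s n)) (T (g j)) = 0" if "n \<le> j" for n j
      using that
    proof (induction n)
      case 0
      show ?case using T_scaleC[of 0 0] csubspace_0[OF csubspace] by simp
    next
      case (Suc n)
      have "cinner (g n) (g j) = 0" "cinner (T (g n)) (T (g j)) = 0"
        using g(4,5)[of n j] Suc.prems cinner_commute[of "g n" "g j"]
          cinner_commute[of "T (g n)" "T (g j)"] by simp_all
      with Suc show ?case
        by (simp add: cinner_add_left cinner_scaleC_left T_add T_scaleC DS g(1) csubspace_scaleC[OF csubspace])
    qed
    have "(\<beta>\<^sup>2 - (c j)\<^sup>2) * (cmod (cinner (?s n) (g j)))\<^sup>2 \<le> \<beta>\<^sup>2 * (norm (?s n))\<^sup>2 - (norm (T (?s n)))\<^sup>2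
        \<and> 0 \<le> \<beta>\<^sup>2 * (norm (?s n))\<^sup>2 - (norm (T (?s n)))\<^sup>2"
    \<comment> \<open>The nonnegativity conjunct is carried along for the case \<open>j = n\<close>,
      where the old sum has no component along \<open>g j\<close>, and for \<open>n < j\<close>,
      where the left side is still 0.\<close>
    proof (induction n)
      case 0
      show ?case using T_scaleC[of 0 0] csubspace_0[OF csubspace] by simp
    next
      case (Suc n)
      have pos: "0 \<le> \<beta>\<^sup>2 - (c k)\<^sup>2" for k
        using c[of k] by (simp add: power_mono less_imp_le)
      have n1: "(norm (?s (Suc n)))\<^sup>2 = (norm (?s n))\<^sup>2 + (cmod (a n))\<^sup>2"
        using pythagoras_cinner[of "?s n" "scaleC (a n) (g n)"] orth[of n n]
        by (simp add: cinner_scaleC_right g(2))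
      have "T (?s (Suc n)) = T (?s n) + scaleC (a n) (T (g n))"
        by (simp add: T_add T_scaleC DS g(1) csubspace_scaleC[OF csubspace])
      then have n2: "(norm (T (?s (Suc n))))\<^sup>2 = (norm (T (?s n)))\<^sup>2 + (cmod (a n))\<^sup>2 * (c n)\<^sup>2"
        using pythagoras_cinner[of "T (?s n)" "scaleC (a n) (T (g n))"] orth[of n n]
        by (simp add: cinner_scaleC_right g(3) power_mult_distrib)
      have eq: "\<beta>\<^sup>2 * (norm (?s (Suc n)))\<^sup>2 - (norm (T (?s (Suc n))))\<^sup>2
          = \<beta>\<^sup>2 * (norm (?s n))\<^sup>2 - (norm (T (?s n)))\<^sup>2 + (\<beta>\<^sup>2 - (c n)\<^sup>2) * (cmod (a n))\<^sup>2"
        unfolding n1 n2 by (simp add: algebra_simps)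
      have sum: "cinner (?s (Suc n)) (g j) = cinner (?s n) (g j) + a n * cinner (g n) (g j)"
        by (simp add: cinner_add_left cinner_scaleC_left)
      have z: "0 \<le> (\<beta>\<^sup>2 - (c n)\<^sup>2) * (cmod (a n))\<^sup>2"
        using pos[of n] by (rule mult_nonneg_nonneg) simp
      note IH = Suc.IH[THEN conjunct1] Suc.IH[THEN conjunct2]
      have "(\<beta>\<^sup>2 - (c j)\<^sup>2) * (cmod (cinner (?s (Suc n)) (g j)))\<^sup>2
          \<le> \<beta>\<^sup>2 * (norm (?s n))\<^sup>2 - (norm (T (?s n)))\<^sup>2 + (\<beta>\<^sup>2 - (c n)\<^sup>2) * (cmod (a n))\<^sup>2"
      proof (rule linorder_cases[of j n])
        assume j: "j = n"
        have "cinner (?s (Suc n)) (g j) = a n"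
          unfolding sum using orth[of n j] j by (simp add: cinner_same g(2))
        with IH(2) j show ?thesis by simp
      next
        assume "j < n"
        then have "cinner (?s (Suc n)) (g j) = cinner (?s n) (g j)"
          unfolding sum using g(4) by simp
        then show ?thesis using add_mono[OF IH(1) z] by (simp only: add_0_right)
      next
        assume "n < j"
        then have "cinner (?s (Suc n)) (g j) = 0" using orth[of "Suc n" j] by simp
        then show ?thesis using add_nonneg_nonneg[OF IH(2) z] by simp
      qed
      with add_nonneg_nonneg[OF IH(2) z] show ?case unfolding eq by blast
    qed
    then show ?thesis unfolding x by blast
  qed
  define M where "M = closure D"
  have M: "csubspace M" "closed M" "M \<subseteq> S"
  proof -
    show "csubspace M" unfolding M_def by (rule csubspace_closure[OF D])
    show "M \<subseteq> S" unfolding M_def using DS by (intro closure_minimal S) (auto simp: D_def)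
  qed (simp add: M_def)
  have gD: "g k \<in> D" for k
  proof -
    have "(\<Sum>j<Suc k. scaleC (if j = k then 1 else 0) (g j)) = g k"
      by (simp add: if_distrib[of "\<lambda>c. scaleC c _"] cong: if_cong)
    then show ?thesis using D_intro[of "\<lambda>j. if j = k then 1 else 0" "Suc k"] by simp
  qed
  then have gM: "g k \<in> M" for k unfolding M_def using closure_subset by blast
  have gapM: "(\<beta>\<^sup>2 - (c j)\<^sup>2) * (cmod (cinner x (g j)))\<^sup>2 \<le> \<beta>\<^sup>2 * (norm x)\<^sup>2 - (norm (T x))\<^sup>2"
    if xM: "x \<in> M" for x j
  proof -
    obtain X where X: "\<And>n. X n \<in> D" "X \<longlonglongrightarrow> x"
      using xM by (auto simp: M_def closure_sequential)
    have "(\<lambda>n. T (X n)) \<longlonglongrightarrow> T x"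
      using X xM M(3) closure_subset[of D] by (intro T_tendsto) (auto simp: M_def)
    note lims = tendsto_norm[OF this] tendsto_norm[OF X(2)] tendsto_norm[OF tendsto_cinner_left[OF X(2)]]
    show ?thesis
    proof (rule LIMSEQ_le)
      show "(\<lambda>n. (\<beta>\<^sup>2 - (c j)\<^sup>2) * (cmod (cinner (X n) (g j)))\<^sup>2)
          \<longlonglongrightarrow> (\<beta>\<^sup>2 - (c j)\<^sup>2) * (cmod (cinner x (g j)))\<^sup>2"
        by (intro tendsto_mult tendsto_const tendsto_power lims)
      show "(\<lambda>n. \<beta>\<^sup>2 * (norm (X n))\<^sup>2 - (norm (T (X n)))\<^sup>2) \<longlonglongrightarrow> \<beta>\<^sup>2 * (norm x)\<^sup>2 - (norm (T x))\<^sup>2"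
        by (intro tendsto_diff tendsto_mult tendsto_const tendsto_power lims)
    qed (use gap X(1) in blast)
  qed
  have c_sq: "(c j)\<^sup>2 < \<beta>\<^sup>2" for j using c[of j] by (intro power_strict_mono) auto
  have "M \<noteq> {0}" using gM[of 0] g(2)[of 0] by force
  from AN[OF M this] obtain x where x: "x \<in> M" "norm x = 1" "norm (T x) = onorm_on M T"
    by (auto simp: norm_attaining_on_def)
  have "c k \<le> onorm_on M T" for k
    using onorm_on_bound[OF gM, of T K k] T_bound M(3) g(2,3)[of k] by auto
  moreover have "c \<longlonglongrightarrow> \<beta> - \<beta> * 0"
    unfolding c_def by (intro tendsto_diff tendsto_mult tendsto_const LIMSEQ_Suc[OF LIMSEQ_inverse_real_of_nat])
  ultimately have "\<beta> \<le> norm (T x)" unfolding x(3) by (intro LIMSEQ_le_const2[of c]) auto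
  then have "\<beta>\<^sup>2 * (norm x)\<^sup>2 - (norm (T x))\<^sup>2 \<le> 0" using \<beta>(1) x(2) by (simp add: power_mono)
  note le = order_trans[OF gapM[OF x(1)] this]
  \<comment> \<open>A unit vector at which the norm is attained leaves no gap, so it is orthogonal
    to every \<open>g j\<close>. Hence it is orthogonal to the closed span, to which it
    belongs.\<close>
  have xg: "cinner x (g j) = 0" for j
    using le[of j] c_sq[of j] by (auto simp: mult_le_0_iff)
  have xD: "cinner x y = 0" if yD: "y \<in> D" for y
  proof -
    obtain a n where y: "y = (\<Sum>k<n. scaleC (a k) (g k))" using yD by (auto simp: D_def)
    show ?thesis
      unfolding y by (induction n) (simp_all add: cinner_add_right cinner_scaleC_right xg)
  qed
  obtain X where X: "\<And>n. X n \<in> D" "X \<longlonglongrightarrow> x"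
    using x(1) by (auto simp: M_def closure_sequential)
  from tendsto_cinner_right[OF X(2), of x] have "cinner x x = 0"
    by (simp add: xD X(1) LIMSEQ_const_iff)
  then show False using x(2) by (simp add: cinner_same)
qed

end

lemma AN_operator_is_compact:
  assumes "csubspace S" "closed S" "T \<in> AN_operators S R"
    and "\<And>n. e n \<in> S" "\<And>n. norm (e n) = 1" "\<And>g. (\<lambda>n. cinner (e n) g) \<longlonglongrightarrow> 0"
      "(\<lambda>n. T (e n)) \<longlonglongrightarrow> 0"
  shows "T \<in> compact_operators S R"
proof -
  have T: "T \<in> bounded_operators S R" using assms(3) by (simp add: AN_operators_def)
  with assms(1) obtain K where "bounded_operator_on S T K" by (rule bounded_operators_locale)
  then interpret bounded_operator_on S T K .
  have "compact (closure (T ` (S \<inter> cball 0 1)))"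
    using assms(3) by (intro compact_if_norm_attaining_on[where e = e] assms) (auto simp: AN_operators_def)
  with T show ?thesis by (simp add: compact_operators_def)
qed

section \<open>Fourier analysis on the circle\<close>

text \<open>The measure before completion. Its measurable sets are exactly the traces of Borel sets
  on the circle, so explicit computations are made here and then carried over.\<close>

abbreviation borel_circle :: "complex measure" where
  "borel_circle \<equiv> distr (restrict_space lborel {0..<1})
     (restrict_space borel (sphere 0 1)) (\<lambda>t. cis (2 * pi * t))"

lemma borel_measurable_circle_continuous:
  fixes h :: "complex \<Rightarrow> 'a::topological_space"
  assumes "continuous_on (sphere 0 1) h"
  shows "h \<in> borel_measurable circle_measure"
proof -
  have "h \<in> borel_measurable (restrict_space borel (sphere 0 1))"
    by (rule borel_measurable_continuous_on_restrict[OF assms])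
  then show ?thesis unfolding circle_measure_def by (intro measurable_completion) simp
qed

lemma ess_bounded_continuous:
  assumes "continuous_on (sphere 0 1) h"
  shows "ess_bounded h"
proof -
  have "bounded (h ` sphere 0 1)"
    by (intro compact_imp_bounded compact_continuous_image assms compact_sphere)
  then obtain C where "\<forall>z\<in>sphere 0 1. cmod (h z) \<le> C" unfolding bounded_iff by blast
  then have "AE z in circle_measure. cmod (h z) \<le> C" by (intro AE_I2) simp
  with borel_measurable_circle_continuous[OF assms] show ?thesis
    by (auto simp: ess_bounded_def)
qed

lemma sets_circle_borel: "A \<in> sets borel \<Longrightarrow> A \<inter> sphere 0 1 \<in> sets circle_measure"
  unfolding circle_measure_def
  by (intro sets_completionI_sets) (auto simp: sets_restrict_space)

lemma cnj_eq_inverse: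
  assumes "cmod z = 1"
  shows "cnj z = inverse z"
proof -
  have "z * cnj z = 1" using complex_norm_square[of z] assms by simp
  then show ?thesis by (rule inverse_unique[symmetric])
qed

lemma integral_circle_powi: "(\<integral>z. z powi k \<partial>circle_measure) = (if k = 0 then 1 else 0)"
proof -
  have meas: "(\<lambda>z::complex. z powi k) \<in> borel_measurable (restrict_space borel (sphere 0 1))"
    by (intro borel_measurable_continuous_on_restrict continuous_intros) auto
  have "(\<integral>z. z powi k \<partial>circle_measure) = (\<integral>z. z powi k \<partial>borel_circle)"
    unfolding circle_measure_def using meas by (intro integral_completion) simp
  also have "\<dots> = (\<integral>t. cis (2 * pi * t) powi k \<partial>restrict_space lborel {0..<1})"
    by (rule integral_distr[OF cis_measurable_circle meas])
  also have "\<dots> = (\<integral>t. indicator {0..<1} t *\<^sub>R cis (2 * pi * k * t) \<partial>lborel)"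
    by (subst integral_restrict_space) (simp_all add: cis_power_int mult_ac)
  \<comment> \<open>The fundamental theorem of calculus wants a closed interval; the added end point
    is a null set.\<close>
  also have "\<dots> = (\<integral>t. indicator {0..1} t *\<^sub>R cis (2 * pi * k * t) \<partial>lborel)"
  proof (rule integral_cong_AE)
    show "AE t in lborel. indicator {0..<1} t *\<^sub>R cis (2 * pi * k * t)
        = indicator {0..1} t *\<^sub>R cis (2 * pi * k * t)"
      using AE_lborel_singleton[of 1] by eventually_elim (auto simp: indicator_def)
  qed (intro borel_measurable_scaleR borel_measurable_indicator borel_measurable_continuous_onI
      continuous_intros; simp)+
  also have "\<dots> = (if k = 0 then 1 else 0)"
  proof (cases "k = 0")
    case False
    define F where "F t = cis (2 * pi * k * t) / (2 * pi * k * \<i>)" for t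
    have "(\<integral>t. indicator {0..1} t *\<^sub>R cis (2 * pi * k * t) \<partial>lborel) = F 1 - F 0"
    proof (rule integral_FTC_Icc)
      fix t :: real
      have "((\<lambda>t. exp (\<i> * of_real (2 * pi * k * t)) / (2 * pi * k * \<i>)) has_vector_derivative
          exp (\<i> * of_real (2 * pi * k * t))) (at t within {0..1})"
        using False by (auto intro!: derivative_eq_intros has_vector_derivative_real_field simp: field_simps)
      then show "(F has_vector_derivative cis (2 * pi * k * t)) (at t within {0..1})"
        by (simp add: F_def[abs_def] cis_conv_exp)
    qed (auto intro!: continuous_intros)
    also have "\<dots> = 0"
      using cis_multiple_2pi[of "of_int k"] by (simp add: F_def)
    finally show ?thesis using False by simp
  qed simp
  finally show ?thesis .
qed

lemma cinner_zpow: "cinner (zpow m) (zpow n) = (if m = n then 1 else 0)"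
proof -
  have "cinner (zpow m) (zpow n) = (\<integral>z. z powi m * cnj (z powi n) \<partial>circle_measure)"
    by transfer simp
  also have "\<dots> = (\<integral>z. z powi (m - n) \<partial>circle_measure)"
  proof (rule Bochner_Integration.integral_cong)
    fix z assume "z \<in> space circle_measure"
    then have z: "cmod z = 1" by simp
    then have "z \<noteq> 0" "cnj z = inverse z" by (auto intro: cnj_eq_inverse)
    then show "z powi m * cnj (z powi n) = z powi (m - n)"
      by (simp add: power_int_diff divide_inverse power_int_inverse)
  qed simp
  finally show ?thesis by (simp add: integral_circle_powi)
qed

lemma norm_zpow [simp]: "norm (zpow n) = 1"
proof -
  have "complex_of_real ((norm (zpow n))\<^sup>2) = of_real 1"
    using cinner_zpow[of n n] by (simp only: cinner_same) simp
  then have "(norm (zpow n))\<^sup>2 = 1\<^sup>2" by (simp only: of_real_eq_iff power_one)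
  then show ?thesis by (rule power2_eq_imp_eq) simp_all
qed

section \<open>Uniqueness of Fourier coefficients\<close>

definition vanishing_coeffs :: "(complex \<Rightarrow> complex) \<Rightarrow> bool" where
  "vanishing_coeffs f \<longleftrightarrow>
     square_integrable f \<and> (\<forall>n::int. (\<integral>z. f z * z powi n \<partial>circle_measure) = 0)"

lemma integrable_mult_powi:
  "square_integrable f \<Longrightarrow> integrable circle_measure (\<lambda>z. f z * z powi n)"
  using square_integrable_integrable[OF square_integrable_mult[OF ess_bounded_powi]]
  by (simp add: mult.commute)

text \<open>On the circle \<open>cnj z\<close> is the inverse of \<open>z\<close>, so multiplying by
  \<open>z\<close> or \<open>cnj z\<close> only shifts the coefficients. The induction leaves
  \<open>f\<close> arbitrary because a product of polynomials is treated by two successive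
  multiplications.\<close>

lemma vanishing_coeffs_mult_polynomial:
  assumes "real_polynomial_function p" "vanishing_coeffs f"
  shows "vanishing_coeffs (\<lambda>z. f z * of_real (p z))"
  using assms
proof (induction arbitrary: f)
  case (linear p)
  have sq: "square_integrable f" and int: "(\<integral>z. f z * z powi n \<partial>circle_measure) = 0" for n
    using linear(2) by (auto simp: vanishing_coeffs_def)
  \<comment> \<open>A real linear function on the plane is
    \<open>Re z * p 1 + Im z * p \<i>\<close>. Writing real and imaginary part through
    \<open>z\<close> and \<open>cnj z\<close> gives these coefficients.\<close>
  define a where "a = of_real (p 1) / 2 + of_real (p \<i>) / (2 * \<i>)"
  define b where "b = of_real (p 1) / 2 - of_real (p \<i>) / (2 * \<i>)"
  have lin: "of_real (p z) = a * z + b * cnj z" for z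
  proof -
    have "z = Re z *\<^sub>R 1 + Im z *\<^sub>R \<i>" by (simp add: complex_eq_iff)
    then have "p z = p (Re z *\<^sub>R 1 + Im z *\<^sub>R \<i>)" by simp
    also have "\<dots> = Re z * p 1 + Im z * p \<i>"
      using linear(1) by (simp only: linear_simps real_scaleR_def)
    finally show ?thesis by (simp add: a_def b_def complex_eq_iff field_simps)
  qed
  have "ess_bounded (\<lambda>z. of_real (p z))"
    using linear(1) by (intro ess_bounded_continuous continuous_intros linear_continuous_on)
  from square_integrable_mult[OF this sq]
  have "square_integrable (\<lambda>z. f z * of_real (p z))" by (simp add: mult.commute)
  moreover have "(\<integral>z. f z * of_real (p z) * z powi n \<partial>circle_measure) = 0" for n
  proof -
    have "(\<integral>z. f z * of_real (p z) * z powi n \<partial>circle_measure)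
        = (\<integral>z. a * (f z * z powi (n + 1)) + b * (f z * z powi (n - 1)) \<partial>circle_measure)"
    proof (rule Bochner_Integration.integral_cong)
      fix z assume "z \<in> space circle_measure"
      then have z: "cmod z = 1" by simp
      then have "z \<noteq> 0" "cnj z = inverse z" by (auto intro: cnj_eq_inverse)
      then show "f z * of_real (p z) * z powi n = a * (f z * z powi (n + 1)) + b * (f z * z powi (n - 1))"
        by (simp add: lin power_int_add power_int_diff field_simps)
    qed simp
    also have "\<dots> = 0" using integrable_mult_powi[OF sq] int by simp
    finally show ?thesis .
  qed
  ultimately show ?case by (simp add: vanishing_coeffs_def)
next
  case (const c)
  then have "square_integrable (\<lambda>z. c * f z)"
    by (intro square_integrable_scale) (simp add: vanishing_coeffs_def)
  with const show ?case
    by (simp add: vanishing_coeffs_def mult.commute[of _ "of_real c"] mult.assoc)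
next
  case (add p q)
  from add.IH(1)[OF add.prems] add.IH(2)[OF add.prems]
  show ?case
    using square_integrable_add[of "\<lambda>z. f z * of_real (p z)" "\<lambda>z. f z * of_real (q z)"]
      integrable_mult_powi[of "\<lambda>z. f z * of_real (p z)"] integrable_mult_powi[of "\<lambda>z. f z * of_real (q z)"]
    by (simp add: vanishing_coeffs_def distrib_left distrib_right)
next
  case (mult p q)
  from mult.IH(2)[OF mult.IH(1)[OF mult.prems]] show ?case by (simp add: mult.assoc)
qed

text \<open>By Stone-Weierstrass \<open>h\<close> is uniformly close on the circle to a polynomial,
  against which \<open>f\<close> integrates to 0. The error is at most \<open>e\<close> times the
  \<open>L^1\<close> norm of \<open>f\<close>.\<close>

lemma vanishing_coeffs_continuous:
  assumes f: "vanishing_coeffs f" and h: "continuous_on (sphere 0 1) h"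
  shows "(\<integral>z. f z * complex_of_real (h z) \<partial>circle_measure) = 0"
proof -
  have sq: "square_integrable f" using f by (simp add: vanishing_coeffs_def)
  define A where "A = (\<integral>z. cmod (f z) \<partial>circle_measure)"
  have intf: "integrable circle_measure (\<lambda>z. cmod (f z))"
    by (rule integrable_norm[OF square_integrable_integrable[OF sq]])
  have le: "cmod (\<integral>z. f z * of_real (h z) \<partial>circle_measure) \<le> e * A" if e: "e > 0" for e
  proof -
    obtain p where p: "real_polynomial_function p" "\<And>z. z \<in> sphere 0 1 \<Longrightarrow> \<bar>h z - p z\<bar> < e"
      using Stone_Weierstrass_real_polynomial_function[OF compact_sphere h e] by blast
    have ph: "vanishing_coeffs (\<lambda>z. f z * of_real (p z))"
      by (rule vanishing_coeffs_mult_polynomial[OF p(1) f])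
    then have p0: "(\<integral>z. f z * of_real (p z) \<partial>circle_measure) = 0"
      unfolding vanishing_coeffs_def by (metis (no_types, lifting) Bochner_Integration.integral_cong mult.right_neutral power_int_0_right)
    have intp: "integrable circle_measure (\<lambda>z. f z * of_real (p z))"
      using ph by (intro square_integrable_integrable) (simp add: vanishing_coeffs_def)
    have "ess_bounded (\<lambda>z. complex_of_real (h z))"
      using h by (intro ess_bounded_continuous continuous_intros)
    from square_integrable_integrable[OF square_integrable_mult[OF this sq]]
    have inth: "integrable circle_measure (\<lambda>z. f z * of_real (h z))" by (simp add: mult.commute)
    have "(\<integral>z. f z * of_real (h z) \<partial>circle_measure) = (\<integral>z. f z * of_real (h z) - f z * of_real (p z) \<partial>circle_measure)"
      using inth intp p0 by simp
    also have "cmod \<dots> \<le> (\<integral>z. cmod (f z * of_real (h z) - f z * of_real (p z)) \<partial>circle_measure)"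
      by (rule integral_norm_bound)
    also have "\<dots> \<le> (\<integral>z. e * cmod (f z) \<partial>circle_measure)"
    proof (rule integral_mono)
      show "integrable circle_measure (\<lambda>z. cmod (f z * of_real (h z) - f z * of_real (p z)))"
        using inth intp by simp
      show "integrable circle_measure (\<lambda>z. e * cmod (f z))" using intf by simp
      fix z assume "z \<in> space circle_measure"
      then have "\<bar>h z - p z\<bar> \<le> e" using p(2)[of z] by simp
      then have "cmod (f z) * \<bar>h z - p z\<bar> \<le> cmod (f z) * e" by (rule mult_left_mono) simp
      moreover have "f z * of_real (h z) - f z * of_real (p z) = f z * of_real (h z - p z)"
        by (simp add: right_diff_distrib)
      ultimately show "cmod (f z * of_real (h z) - f z * of_real (p z)) \<le> e * cmod (f z)"
        by (simp only: norm_mult norm_of_real mult.commute)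
    qed
    also have "\<dots> = e * A" by (simp add: A_def)
    finally show ?thesis .
  qed
  have "A \<ge> 0" by (simp add: A_def)
  have "cmod (\<integral>z. f z * of_real (h z) \<partial>circle_measure) \<le> 0"
  proof (rule field_le_epsilon)
    fix e :: real assume e: "e > 0"
    \<comment> \<open>Dividing by \<open>A + 1\<close> avoids a separate case for
      \<open>A = 0\<close>.\<close>
    have "e / (A + 1) * A \<le> e" using e \<open>A \<ge> 0\<close> by (simp add: field_simps)
    then show "cmod (\<integral>z. f z * of_real (h z) \<partial>circle_measure) \<le> 0 + e"
      using le[of "e / (A + 1)"] e \<open>A \<ge> 0\<close> by simp
  qed
  then show ?thesis by simp
qed

lemma vanishing_coeffs_closed_set:
  assumes f: "vanishing_coeffs f" and A: "closed A"
  shows "(LINT z : A \<inter> sphere 0 1 | circle_measure. f z) = 0"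
\<comment> \<open>\<open>infdist\<close> to the empty set is 0 by convention, so the cut-off
  functions \<open>h n\<close> would be constantly 1 there and miss the indicator.\<close>
proof (cases "A = {}")
  case False
  have sq: "square_integrable f" using f by (simp add: vanishing_coeffs_def)
  have [measurable]: "f \<in> borel_measurable circle_measure"
    using sq by (rule square_integrable_measurable)
  define h where "h n z = max 0 (1 - real n * infdist z A)" for n z
  have cont: "continuous_on (sphere 0 1) (h n)" for n
    unfolding h_def by (intro continuous_intros)
  have "(\<lambda>n. \<integral>z. f z * of_real (h n z) \<partial>circle_measure)
      \<longlonglongrightarrow> (\<integral>z. indicator (A \<inter> sphere 0 1) z *\<^sub>R f z \<partial>circle_measure)"
  proof (rule integral_dominated_convergence)
    show "integrable circle_measure (\<lambda>z. cmod (f z))"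
      by (rule integrable_norm[OF square_integrable_integrable[OF sq]])
    have "A \<inter> sphere 0 1 \<in> sets circle_measure" using A by (intro sets_circle_borel) simp
    then show "(\<lambda>z. indicator (A \<inter> sphere 0 1) z *\<^sub>R f z) \<in> borel_measurable circle_measure"
      by measurable
    have "(\<lambda>z. complex_of_real (h n z)) \<in> borel_measurable circle_measure" for n
      using cont by (intro borel_measurable_circle_continuous continuous_intros)
    then show "(\<lambda>z. f z * of_real (h n z)) \<in> borel_measurable circle_measure" for n
      by measurable
    have "cmod (f z * of_real (h n z)) \<le> cmod (f z)" for n z
    proof -
      have "0 \<le> h n z" "h n z \<le> 1" by (auto simp: h_def infdist_nonneg)
      then show ?thesis by (simp add: norm_mult mult_left_le)
    qed
    then show "AE z in circle_measure. cmod (f z * of_real (h n z)) \<le> cmod (f z)" for n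
      by simp
    show "AE z in circle_measure. (\<lambda>n. f z * of_real (h n z))
        \<longlonglongrightarrow> indicator (A \<inter> sphere 0 1) z *\<^sub>R f z"
    proof (rule AE_I2)
      fix z assume z: "z \<in> space circle_measure"
      have "(\<lambda>n. h n z) \<longlonglongrightarrow> indicator A z"
      proof (cases "z \<in> A")
        case True
        then show ?thesis by (simp add: h_def)
      next
        case nz: False
        then have pos: "infdist z A > 0"
          using A False by (metis in_closed_iff_infdist_zero infdist_nonneg less_eq_real_def)
        obtain N :: nat where N: "1 / infdist z A < N" using reals_Archimedean2 by blast
        have "h n z = 0" if "n \<ge> N" for n
        proof -
          have "1 / infdist z A \<le> n" using N that by (meson less_imp_le le_less_trans of_nat_le_iff order_trans)
          then have "1 \<le> real n * infdist z A" using pos by (simp add: divide_le_eq)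
          then show ?thesis by (simp add: h_def)
        qed
        then have "\<forall>\<^sub>F n in sequentially. h n z = 0" by (auto simp: eventually_sequentially)
        then show ?thesis using nz by (simp add: tendsto_eventually)
      qed
      then have "(\<lambda>n. f z * of_real (h n z)) \<longlonglongrightarrow> f z * of_real (indicator A z)"
        by (intro tendsto_intros)
      then show "(\<lambda>n. f z * of_real (h n z)) \<longlonglongrightarrow> indicator (A \<inter> sphere 0 1) z *\<^sub>R f z"
        using z by (cases "z \<in> A") auto
    qed
  qed
  then show ?thesis
    by (simp add: vanishing_coeffs_continuous[OF f cont] LIMSEQ_const_iff set_lebesgue_integral_def)
qed (simp add: set_lebesgue_integral_def)

text \<open>Closed sets are stable under intersection and generate the Borel sets, and the sets over
  which \<open>f\<close> integrates to 0 form a Dynkin system. For complements this needs the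
  integral over the whole circle, which is the coefficient with exponent 0.\<close>

lemma vanishing_coeffs_borel_set:
  assumes f: "vanishing_coeffs f" and A: "A \<in> sets borel"
  shows "(LINT z : A \<inter> sphere 0 1 | circle_measure. f z) = 0"
proof -
  have int: "integrable circle_measure f"
    using f by (intro square_integrable_integrable) (simp add: vanishing_coeffs_def)
  have set_int: "set_integrable circle_measure (B \<inter> sphere 0 1) f" if "B \<in> sets borel" for B
    unfolding set_integrable_def using sets_circle_borel[OF that] int
    by (rule integrable_mult_indicator)
  have A': "A \<in> sigma_sets UNIV (Collect closed)" using A by (simp add: borel_eq_closed)
  have borel: "B \<in> sets borel" if "B \<in> sigma_sets UNIV (Collect closed)" for B :: "complex set"
    using that by (simp add: borel_eq_closed)
  have "Int_stable (Collect closed :: complex set set)" by (auto simp: Int_stable_def)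
  moreover have "(Collect closed :: complex set set) \<subseteq> Pow UNIV" by simp
  ultimately show ?thesis using A'
  proof (induction rule: sigma_sets_induct_disjoint)
    case (basic B)
    then show ?case using vanishing_coeffs_closed_set[OF f] by simp
  next
    case empty
    show ?case by (simp add: set_lebesgue_integral_def)
  next
    case (compl B)
    have "(LINT z : (B \<inter> sphere 0 1) \<union> ((UNIV - B) \<inter> sphere 0 1) | circle_measure. f z)
        = (LINT z : B \<inter> sphere 0 1 | circle_measure. f z)
          + (LINT z : (UNIV - B) \<inter> sphere 0 1 | circle_measure. f z)"
      using borel[OF compl.hyps] by (intro set_integral_Un set_int) auto
    moreover have "(B \<inter> sphere 0 1) \<union> ((UNIV - B) \<inter> sphere 0 1) = sphere 0 1" by auto
    moreover have "(LINT z : sphere 0 1 | circle_measure. f z) = 0"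
      using set_integral_space[OF int] f[unfolded vanishing_coeffs_def, THEN conjunct2, THEN spec[of _ 0]] by simp
    ultimately show ?case using compl.IH by simp
  next
    case (union B)
    have B: "B i \<in> sets borel" for i using borel union.hyps by blast
    have "(LINT z : (\<Union>i. B i \<inter> sphere 0 1) | circle_measure. f z)
        = (\<Sum>i. LINT z : B i \<inter> sphere 0 1 | circle_measure. f z)"
    proof (rule lebesgue_integral_countable_add)
      show "B i \<inter> sphere 0 1 \<in> sets circle_measure" for i by (rule sets_circle_borel[OF B])
      show "(B i \<inter> sphere 0 1) \<inter> (B j \<inter> sphere 0 1) = {}" if "i \<noteq> j" for i j
        using union.hyps(1) that by (auto simp: disjoint_family_on_def)
      have "(\<Union>i. B i \<inter> sphere 0 1) = (\<Union>i. B i) \<inter> sphere 0 1" by auto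
      then show "set_integrable circle_measure (\<Union>i. B i \<inter> sphere 0 1) f"
        using set_int[of "\<Union>i. B i"] B by auto
    qed
    moreover have "(\<Union>i. B i \<inter> sphere 0 1) = (\<Union>i. B i) \<inter> sphere 0 1" by auto
    ultimately show ?case using union.IH by simp
  qed
qed

text \<open>Needed because a sign set of \<open>f\<close> is measurable only for the completed
  measure. Such a set differs from the trace of a Borel set by a null set.\<close>

lemma vanishing_coeffs_measurable_set:
  assumes f: "vanishing_coeffs f" and A: "A \<in> sets circle_measure"
  shows "(LINT z : A | circle_measure. f z) = 0"
proof -
  have fm [measurable]: "f \<in> borel_measurable circle_measure"
    using f by (intro square_integrable_measurable) (simp add: vanishing_coeffs_def)
  obtain S N N' where S: "A = S \<union> N" "N \<subseteq> N'" "N' \<in> null_sets borel_circle" "S \<in> sets borel_circle"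
    using A unfolding circle_measure_def by (elim sets_completionE) blast
  then obtain B where B: "B \<in> sets borel" "S = B \<inter> sphere 0 1"
    by (auto simp: sets_restrict_space)
  have "N' \<in> null_sets circle_measure"
    unfolding circle_measure_def by (rule null_sets_completionI[OF S(3)])
  then have "AE z in circle_measure. z \<notin> N'" by (rule AE_not_in)
  then have ae: "AE z in circle_measure. z \<in> S \<longleftrightarrow> z \<in> A"
    by eventually_elim (use S in auto)
  have "S \<in> sets circle_measure" using B sets_circle_borel by simp
  then have "(LINT z : A | circle_measure. f z) = (LINT z : S | circle_measure. f z)"
    using A ae by (intro set_integral_cong_set) (auto simp: set_borel_measurable_def)
  then show ?thesis using vanishing_coeffs_borel_set[OF f B(1)] B(2) by simp
qed

text \<open>On the set where the real part is positive, a nonnegative function has integral 0 and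
  therefore vanishes almost everywhere.\<close>

lemma vanishing_coeffs_Re_nonpos:
  assumes f: "vanishing_coeffs f"
  shows "AE z in circle_measure. Re (f z) \<le> 0"
proof -
  have sq: "square_integrable f" using f by (simp add: vanishing_coeffs_def)
  have [measurable]: "f \<in> borel_measurable circle_measure"
    using sq by (rule square_integrable_measurable)
  define A where "A = {z \<in> space circle_measure. Re (f z) > 0}"
  have A [measurable]: "A \<in> sets circle_measure" unfolding A_def by measurable
  have int: "integrable circle_measure (\<lambda>z. indicator A z *\<^sub>R f z)"
    using A square_integrable_integrable[OF sq] by (rule integrable_mult_indicator)
  have "0 = Re (\<integral>z. indicator A z *\<^sub>R f z \<partial>circle_measure)"
    using vanishing_coeffs_measurable_set[OF f A] by (simp add: set_lebesgue_integral_def)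
  also have "\<dots> = (\<integral>z. Re (indicator A z *\<^sub>R f z) \<partial>circle_measure)"
    by (rule integral_Re[OF int, symmetric])
  finally have "(\<integral>z. Re (indicator A z *\<^sub>R f z) \<partial>circle_measure) = 0" by simp
  then have "AE z in circle_measure. Re (indicator A z *\<^sub>R f z) = 0"
    using integrable_Re[OF int]
    by (subst (asm) integral_nonneg_eq_0_iff_AE) (auto simp: A_def indicator_def)
  with AE_space show ?thesis
    by eventually_elim (auto simp: A_def indicator_def split: if_splits)
qed

text \<open>Multiplying by 1, -1, \<open>\<i>\<close> and \<open>-\<i>\<close> bounds real and
  imaginary part from both sides.\<close>

lemma vanishing_coeffs_AE_zero:
  assumes f: "vanishing_coeffs f"
  shows "AE z in circle_measure. f z = 0"
proof -
  have "vanishing_coeffs (\<lambda>z. c * f z)" for c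
    using f square_integrable_scale by (auto simp: vanishing_coeffs_def mult.assoc)
  note re = vanishing_coeffs_Re_nonpos[OF this]
  from re[of 1] re[of "-1"] re[of \<i>] re[of "-\<i>"] show ?thesis
    by eventually_elim (auto simp: complex_eq_iff)
qed

lemma fourier_coeff_zero_imp_zero:
  assumes "\<And>n. fourier_coeff f n = 0"
  shows "f = 0"
proof -
  obtain F where F: "square_integrable F" "abs_ltwo F = f" by (rule rep_ltwo)
  have "(\<integral>z. F z * z powi n \<partial>circle_measure) = 0" for n
  proof -
    have "(\<integral>z. F z * z powi n \<partial>circle_measure) = (\<integral>z. F z * cnj (z powi (- n)) \<partial>circle_measure)"
    proof (rule Bochner_Integration.integral_cong)
      fix z assume "z \<in> space circle_measure"
      then have "cnj z = inverse z" by (auto intro: cnj_eq_inverse)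
      then show "F z * z powi n = F z * cnj (z powi (- n))"
        by (simp add: power_int_minus power_int_inverse)
    qed simp
    also have "\<dots> = fourier_coeff f (- n)"
      unfolding fourier_coeff_def F(2)[symmetric] zpow.abs_eq
      by (simp add: zpow_def cinner_abs_ltwo F(1) square_integrable_powi)
    finally show ?thesis using assms by simp
  qed
  with F(1) have "vanishing_coeffs F" by (simp add: vanishing_coeffs_def)
  from abs_ltwo_eq_zero[OF F(1) vanishing_coeffs_AE_zero[OF this]] show ?thesis using F(2) by simp
qed

section \<open>Trigonometric polynomials and the Hardy space\<close>

lemma csubspace_Inter: "(\<And>S. S \<in> X \<Longrightarrow> csubspace S) \<Longrightarrow> csubspace (\<Inter>X)"
  unfolding csubspace_def by blast

text \<open>Trigonometric polynomials are represented as the hull of the monomials. A property then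
  holds for all of them once it defines a subspace and holds for every \<open>zpow k\<close>, with
  no manipulation of finite sums.\<close>

lemma csubspace_hull: "csubspace (csubspace hull A)"
  by (rule hull_in) (simp add: csubspace_Inter)

text \<open>What remains of \<open>f\<close> after projection onto the closed span is orthogonal to
  every monomial, so all its Fourier coefficients vanish.\<close>

lemma closure_trigonometric_polynomials: "closure (csubspace hull range zpow) = UNIV"
proof -
  let ?M = "closure (csubspace hull range zpow)"
  have M: "csubspace ?M" by (intro csubspace_closure csubspace_hull)
  have "f \<in> ?M" for f
  proof -
    obtain g where g: "g \<in> ?M" "\<And>h. h \<in> ?M \<Longrightarrow> cinner (f - g) h = 0"
      using orthogonal_decomposition[OF M closed_closure] by blast
    have "zpow n \<in> ?M" for n
      using hull_subset[of "range zpow" csubspace] closure_subset by blast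
    then have "f - g = 0"
      using g(2) by (intro fourier_coeff_zero_imp_zero) (simp add: fourier_coeff_def)
    with g(1) show ?thesis by simp
  qed
  then show ?thesis by blast
qed

lemma trigonometric_approximation:
  assumes "e > 0"
  obtains p where "p \<in> csubspace hull range zpow" "norm (f - p) < e"
proof -
  have "f \<in> closure (csubspace hull range zpow)"
    by (simp add: closure_trigonometric_polynomials)
  then obtain p where "p \<in> csubspace hull range zpow" "dist p f < e"
    using assms unfolding closure_approachable by blast
  with that show ?thesis by (simp add: dist_norm norm_minus_commute)
qed

lemma csubspace_orthogonal_tail:
  "csubspace {p. \<exists>N. \<forall>n\<ge>N. cinner (zpow (int n)) p = 0}"
  unfolding csubspace_def
proof (intro conjI ballI allI)
  fix p q assume "p \<in> {p. \<exists>N. \<forall>n\<ge>N. cinner (zpow (int n)) p = 0}"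
    "q \<in> {p. \<exists>N. \<forall>n\<ge>N. cinner (zpow (int n)) p = 0}"
  then obtain N N' where "\<forall>n\<ge>N. cinner (zpow (int n)) p = 0" "\<forall>n\<ge>N'. cinner (zpow (int n)) q = 0"
    by blast
  then have "\<forall>n\<ge>max N N'. cinner (zpow (int n)) (p + q) = 0" by (simp add: cinner_add_right)
  then show "p + q \<in> {p. \<exists>N. \<forall>n\<ge>N. cinner (zpow (int n)) p = 0}" by blast
qed (auto simp: cinner_scaleC_right)

text \<open>The Riemann-Lebesgue lemma, read as weak convergence of the monomials to 0. For a
  trigonometric polynomial the inner products are eventually 0, and Cauchy-Schwarz bounds the error
  of the approximation uniformly in \<open>n\<close>.\<close>

lemma cinner_zpow_tendsto_zero: "(\<lambda>n. cinner (zpow (int n)) f) \<longlonglongrightarrow> 0"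
proof (rule LIMSEQ_I)
  fix e :: real assume e: "e > 0"
  obtain p where p: "p \<in> csubspace hull range zpow" "norm (f - p) < e"
    by (rule trigonometric_approximation[OF e])
  have "csubspace hull range zpow \<subseteq> {p. \<exists>N. \<forall>n\<ge>N. cinner (zpow (int n)) p = 0}"
  proof (rule hull_minimal)
    \<comment> \<open>From \<open>k + 1\<close> on the exponents differ from \<open>k\<close>. For
      negative \<open>k\<close> the conversion \<open>nat\<close> gives 0, which is enough.\<close>
    have "\<forall>n\<ge>nat (k + 1). cinner (zpow (int n)) (zpow k) = 0" for k
      by (auto simp: cinner_zpow)
    then show "range zpow \<subseteq> {p. \<exists>N. \<forall>n\<ge>N. cinner (zpow (int n)) p = 0}" by blast
  qed (rule csubspace_orthogonal_tail)
  with p(1) obtain N where N: "\<And>n. n \<ge> N \<Longrightarrow> cinner (zpow (int n)) p = 0" by blast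
  have "norm (cinner (zpow (int n)) f - 0) < e" if "n \<ge> N" for n
  proof -
    have "cinner (zpow (int n)) f = cinner (zpow (int n)) (f - p)"
      using N[OF that] by (simp add: cinner_diff_right)
    then show ?thesis using cinner_Cauchy_Schwarz[of "zpow (int n)" "f - p"] p(2) by simp
  qed
  then show "\<exists>N. \<forall>n\<ge>N. norm (cinner (zpow (int n)) f - 0) < e" by blast
qed

lemma csubspace_hardy2: "csubspace hardy2"
  by (simp add: csubspace_def hardy2_def fourier_coeff_def cinner_add_left cinner_scaleC_left)

lemma closed_hardy2: "closed hardy2"
proof (rule closed_sequential_limits[THEN iffD2], intro allI impI, elim conjE)
  fix X f assume X: "\<forall>n. X n \<in> hardy2" "X \<longlonglongrightarrow> f"
  have "fourier_coeff f k = 0" if "k < 0" for k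
  proof -
    have "(\<lambda>n. fourier_coeff (X n) k) \<longlonglongrightarrow> fourier_coeff f k"
      unfolding fourier_coeff_def by (rule tendsto_cinner_left[OF X(2)])
    then show ?thesis using X(1) that by (simp add: hardy2_def LIMSEQ_const_iff)
  qed
  then show "f \<in> hardy2" by (simp add: hardy2_def)
qed

lemma zpow_in_hardy2: "n \<ge> 0 \<Longrightarrow> zpow n \<in> hardy2"
  by (auto simp: hardy2_def fourier_coeff_def cinner_zpow)

section \<open>The flip operator\<close>

lemma measurable_cnj_restrict:
  "cnj \<in> restrict_space borel (sphere 0 1) \<rightarrow>\<^sub>M restrict_space borel (sphere 0 1)"
  by (intro measurable_restrict_space3 borel_measurable_continuous_onI continuous_intros) auto

text \<open>In the angular parameter conjugation is the map from \<open>t\<close> to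
  \<open>1 - t\<close>, under which Lebesgue measure is invariant. This map does not preserve the
  half-open interval, so the null point 0 is removed before substituting.\<close>

lemma distr_borel_circle_cnj:
  "distr borel_circle (restrict_space borel (sphere 0 1)) cnj = borel_circle"
proof (rule measure_eqI)
  fix A assume "A \<in> sets (distr borel_circle (restrict_space borel (sphere 0 1)) cnj)"
  then have A: "A \<in> sets (restrict_space borel (sphere 0 1))" by simp
  then have AB [measurable]: "A \<in> sets borel" by (auto simp: sets_restrict_space)
  \<comment> \<open>Parameters whose point lies in \<open>A\<close>, for the circle traversed
    forwards (\<open>s = 1\<close>) or backwards (\<open>s = -1\<close>).\<close>
  define B where "B s = {t::real. cis (s * 2 * pi * t) \<in> A}" for s :: real
  have B [measurable]: "B s \<in> sets borel" for s
  proof -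
    have "(\<lambda>t. cis (s * 2 * pi * t)) -` A \<inter> space borel \<in> sets borel"
      by (intro measurable_sets[OF borel_measurable_continuous_onI AB] continuous_intros)
    then show ?thesis by (simp add: B_def vimage_def)
  qed
  have em: "emeasure borel_circle A = emeasure lborel ({0<..<1} \<inter> B 1)"
    if A: "A \<in> sets (restrict_space borel (sphere 0 1))" "\<And>s. B s \<in> sets borel"
      "\<And>s. B s = {t::real. cis (s * 2 * pi * t) \<in> A}" for A and B :: "real \<Rightarrow> real set"
  proof -
    have "(\<lambda>t. cis (2 * pi * t)) -` A \<inter> space (restrict_space lborel {0..<1}) = {0..<1} \<inter> B 1"
      by (auto simp: space_restrict_space A(3))
    then have "emeasure borel_circle A = emeasure lborel ({0..<1} \<inter> B 1)"
      using A(1) cis_measurable_circle by (simp add: emeasure_distr emeasure_restrict_space)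
    also have "\<dots> = emeasure lborel ({0<..<1} \<inter> B 1)"
    proof (rule emeasure_eq_AE)
      show "AE t in lborel. t \<in> {0..<1} \<inter> B 1 \<longleftrightarrow> t \<in> {0<..<1} \<inter> B 1"
        using AE_lborel_singleton[of 0] by eventually_elim auto
    qed (use A(2) in auto)
    finally show ?thesis .
  qed
  have cA: "cnj -` A \<inter> sphere 0 1 \<in> sets (restrict_space borel (sphere 0 1))"
    using measurable_sets[OF measurable_cnj_restrict A] by (simp add: space_restrict_space)
  have "emeasure (distr borel_circle (restrict_space borel (sphere 0 1)) cnj) A
      = emeasure borel_circle (cnj -` A \<inter> sphere 0 1)"
    using A measurable_cnj_restrict by (subst emeasure_distr) (simp_all add: space_restrict_space)
  also have "\<dots> = emeasure lborel ({0<..<1} \<inter> B (-1))"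
    using em[OF cA, of "\<lambda>s. B (- s)", OF B] by (simp add: B_def cis_cnj)
  also have "\<dots> = (\<integral>\<^sup>+ t. indicator ({0<..<1} \<inter> B (-1)) t \<partial>lborel)" by simp
  also have "\<dots> = (\<integral>\<^sup>+ t. indicator ({0<..<1} \<inter> B (-1)) (1 + (-1) * t) \<partial>lborel)"
    using nn_integral_real_affine[of "indicator ({0<..<1} \<inter> B (-1))" "-1" 1] by simp
  also have "\<dots> = (\<integral>\<^sup>+ t. indicator ({0<..<1} \<inter> B 1) t \<partial>lborel)"
  proof (rule nn_integral_cong)
    fix t :: real
    have "cis (- (2 * pi * (1 - t))) = cis (2 * pi * t) * cis (- (2 * pi))"
      unfolding cis_mult by (simp add: algebra_simps)
    also have "cis (- (2 * pi)) = 1" using cis_multiple_2pi[of "-1"] by simp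
    finally show "indicator ({0<..<1} \<inter> B (-1)) (1 + (-1) * t) = (indicator ({0<..<1} \<inter> B 1) t :: ennreal)"
      by (simp add: indicator_def B_def)
  qed
  also have "\<dots> = emeasure lborel ({0<..<1} \<inter> B 1)" by simp
  also have "\<dots> = emeasure borel_circle A"
    using em[OF A, of B, OF B] by (simp add: B_def)
  finally show "emeasure (distr borel_circle (restrict_space borel (sphere 0 1)) cnj) A
      = emeasure borel_circle A" .
qed simp

text \<open>The image of the completed measure under conjugation, taken on the Borel sets, is
  \<open>borel_circle\<close> again. So null sets pull back to null sets, and both claims pass to
  the completion.\<close>

lemma distr_circle_cnj: "distr circle_measure circle_measure cnj = circle_measure"
  and measurable_cnj_circle: "cnj \<in> circle_measure \<rightarrow>\<^sub>M circle_measure"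
proof -
  have meas: "cnj \<in> borel_circle \<rightarrow>\<^sub>M borel_circle"
    using measurable_cnj_restrict by simp
  have "distr (completion borel_circle) borel_circle cnj = distr borel_circle borel_circle cnj"
    by (rule distr_completion[OF meas])
  also have "\<dots> = distr borel_circle (restrict_space borel (sphere 0 1)) cnj"
    by (intro distr_cong) simp_all
  finally have eq: "distr (completion borel_circle) borel_circle cnj = borel_circle"
    by (simp only: distr_borel_circle_cnj)
  have meas': "cnj \<in> completion borel_circle \<rightarrow>\<^sub>M borel_circle"
    by (rule measurable_completion[OF meas])
  show "distr circle_measure circle_measure cnj = circle_measure"
    unfolding circle_measure_def
    by (rule completion.completion_distr_eq[OF meas', unfolded eq, OF refl, symmetric])
  show "cnj \<in> circle_measure \<rightarrow>\<^sub>M circle_measure"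
    unfolding circle_measure_def
    by (rule completion.measurable_completion2[OF meas', unfolded eq, OF order_refl])
qed

lemma integral_circle_cnj:
  fixes f :: "complex \<Rightarrow> 'a::{banach, second_countable_topology}"
  assumes "f \<in> borel_measurable circle_measure"
  shows "(\<integral>z. f (cnj z) \<partial>circle_measure) = (\<integral>z. f z \<partial>circle_measure)"
  using integral_distr[OF measurable_cnj_circle assms] by (simp add: distr_circle_cnj)

lemma AE_circle_cnj:
  "AE z in circle_measure. P z \<Longrightarrow> AE z in circle_measure. P (cnj z)"
  by (rule AE_distrD[OF measurable_cnj_circle, unfolded distr_circle_cnj])

lemma square_integrable_cnj:
  assumes "square_integrable f"
  shows "square_integrable (\<lambda>z. f (cnj z))"
proof -
  have "f \<in> borel_measurable circle_measure" using assms by (simp add: square_integrable_def)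
  then have "(\<lambda>z. f (cnj z)) \<in> borel_measurable circle_measure"
    by (rule measurable_compose[OF measurable_cnj_circle])
  moreover have "integrable circle_measure (\<lambda>z. (cmod (f (cnj z)))\<^sup>2)"
    using integrable_distr[OF measurable_cnj_circle, of "\<lambda>z. (cmod (f z))\<^sup>2"] assms
    by (simp add: distr_circle_cnj square_integrable_def)
  ultimately show ?thesis by (simp add: square_integrable_def)
qed

lemma square_integrable_reflection:
  "square_integrable f \<Longrightarrow> square_integrable (\<lambda>z. inverse z * f (cnj z))"
  using square_integrable_mult[OF ess_bounded_powi[of "-1"] square_integrable_cnj] by simp

text \<open>A closed formula for \<open>J\<close>: on the circle \<open>cnj z\<close> is the inverse
  of \<open>z\<close>, so \<open>z powi (- n)\<close> is sent to \<open>z powi n\<close> divided by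
  \<open>z\<close>.\<close>

lift_definition reflection :: "ltwo \<Rightarrow> ltwo" is "\<lambda>f z. inverse z * f (cnj z)"
proof (elim conjE, intro conjI)
  fix f g assume "square_integrable f" "square_integrable g"
  then show "square_integrable (\<lambda>z. inverse z * f (cnj z))"
    "square_integrable (\<lambda>z. inverse z * g (cnj z))"
    by (simp_all add: square_integrable_reflection)
  assume "AE z in circle_measure. f z = g z"
  from AE_circle_cnj[OF this]
  show "AE z in circle_measure. inverse z * f (cnj z) = inverse z * g (cnj z)"
    by eventually_elim simp
qed

lemma ltwo_eqI:
  assumes "square_integrable f" "square_integrable g" "\<And>z. cmod z = 1 \<Longrightarrow> f z = g z"
  shows "abs_ltwo f = abs_ltwo g"
proof -
  have "AE z in circle_measure. f z = g z" by (rule AE_I2) (simp add: assms)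
  with assms show ?thesis by (intro Quotient_rel_abs[OF Quotient_ltwo]) blast
qed

lemma reflection_abs_ltwo:
  "square_integrable f \<Longrightarrow> reflection (abs_ltwo f) = abs_ltwo (\<lambda>z. inverse z * f (cnj z))"
  by (simp add: reflection.abs_eq)

text \<open>Surjectivity holds because the map is an involution. Inner products are preserved
  because the factor \<open>inverse z\<close> is unimodular and the measure is invariant under
  conjugation.\<close>

lemma unitary_reflection: "unitary_operator reflection"
  unfolding unitary_operator_def
proof (intro conjI allI)
  show "clinear_on UNIV reflection"
    unfolding clinear_on_def
  proof (intro conjI ballI allI)
    fix x y :: ltwo
    show "reflection (x + y) = reflection x + reflection y"
      by transfer (auto intro!: square_integrable_reflection square_integrable_add simp: distrib_left)
    show "reflection (scaleC c x) = scaleC c (reflection x)" for c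
      by transfer (auto intro!: square_integrable_reflection square_integrable_scale simp: mult.left_commute)
  qed
  have "reflection (reflection x) = x" for x
  proof -
    obtain f where f: "square_integrable f" "abs_ltwo f = x" by (rule rep_ltwo)
    have "reflection (reflection x) = abs_ltwo (\<lambda>z. inverse z * (inverse (cnj z) * f (cnj (cnj z))))"
      unfolding f(2)[symmetric] reflection_abs_ltwo[OF f(1)]
      by (rule reflection_abs_ltwo[OF square_integrable_reflection[OF f(1)]])
    also have "\<dots> = abs_ltwo f"
    proof (rule ltwo_eqI)
      show "square_integrable (\<lambda>z. inverse z * (inverse (cnj z) * f (cnj (cnj z))))"
        using square_integrable_reflection[OF square_integrable_reflection[OF f(1)]] by simp
      fix z :: complex assume z: "cmod z = 1"
      then have "z \<noteq> 0" by auto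
      then show "inverse z * (inverse (cnj z) * f (cnj (cnj z))) = f z"
        by (simp add: cnj_eq_inverse[OF z])
    qed (rule f)
    finally show ?thesis using f(2) by simp
  qed
  then show "surj reflection" by (metis surjI)
  fix x y
  obtain f where f: "square_integrable f" "abs_ltwo f = x" by (rule rep_ltwo)
  obtain g where g: "square_integrable g" "abs_ltwo g = y" by (rule rep_ltwo)
  have "cinner (reflection x) (reflection y)
      = (\<integral>z. inverse z * f (cnj z) * cnj (inverse z * g (cnj z)) \<partial>circle_measure)"
    unfolding f(2)[symmetric] g(2)[symmetric] reflection_abs_ltwo[OF f(1)] reflection_abs_ltwo[OF g(1)]
    by (intro cinner_abs_ltwo square_integrable_reflection f g)
  also have "\<dots> = (\<integral>z. f (cnj z) * cnj (g (cnj z)) \<partial>circle_measure)"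
  proof (rule Bochner_Integration.integral_cong)
    fix z assume "z \<in> space circle_measure"
    then have z: "cmod z = 1" by simp
    then have "z \<noteq> 0" by auto
    then show "inverse z * f (cnj z) * cnj (inverse z * g (cnj z)) = f (cnj z) * cnj (g (cnj z))"
      by (simp add: cnj_eq_inverse[OF z])
  qed simp
  also have "\<dots> = (\<integral>z. f z * cnj (g z) \<partial>circle_measure)"
    by (rule integral_circle_cnj[of "\<lambda>z. f z * cnj (g z)"])
       (rule borel_measurable_integrable[OF square_integrable_mult_integrable[OF f(1) g(1)]])
  also have "\<dots> = cinner x y" using f g cinner_abs_ltwo by auto
  finally show "cinner (reflection x) (reflection y) = cinner x y" .
qed

lemma reflection_zpow: "reflection (zpow (- n)) = zpow (n - 1)"
proof -
  have "zpow k = abs_ltwo (\<lambda>z. z powi k)" for k by (simp add: zpow_def)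
  then have "reflection (zpow (- n)) = abs_ltwo (\<lambda>z. inverse z * cnj z powi (- n))"
    by (simp add: reflection_abs_ltwo[OF square_integrable_powi])
  also have "\<dots> = abs_ltwo (\<lambda>z. z powi (n - 1))"
  proof (rule ltwo_eqI)
    show "square_integrable (\<lambda>z. inverse z * cnj z powi (- n))"
      by (rule square_integrable_reflection[OF square_integrable_powi])
    fix z :: complex assume z: "cmod z = 1"
    then have "z \<noteq> 0" by auto
    then show "inverse z * cnj z powi (- n) = z powi (n - 1)"
      by (simp add: cnj_eq_inverse[OF z] power_int_inverse power_int_minus power_int_diff divide_inverse mult.commute)
  qed (rule square_integrable_powi)
  finally show ?thesis by (simp add: zpow_def)
qed

text \<open>Preservation of inner products turns the values on monomials into values of all Fourier
  coefficients of \<open>U f\<close>. These determine \<open>U f\<close>, so no appeal to density or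
  continuity of \<open>U\<close> is made.\<close>

lemma flip_operator_eq: "flip_operator = reflection"
  unfolding flip_operator_def
proof (rule the_equality)
  show "unitary_operator reflection \<and> (\<forall>n. reflection (zpow (- n)) = zpow (n - 1))"
    using unitary_reflection reflection_zpow by blast
  fix U assume U: "unitary_operator U \<and> (\<forall>n. U (zpow (- n)) = zpow (n - 1))"
  have coeff: "cinner (V f) (zpow k) = cinner f (zpow (- (k + 1)))"
    if "unitary_operator V \<and> (\<forall>n. V (zpow (- n)) = zpow (n - 1))" for V f k
  proof -
    have "V (zpow (- (k + 1))) = zpow k" using that by (metis add_diff_cancel)
    moreover have "cinner (V f) (V (zpow (- (k + 1)))) = cinner f (zpow (- (k + 1)))"
      using that unfolding unitary_operator_def by blast
    ultimately show ?thesis by (simp only:)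
  qed
  show "U = reflection"
  proof
    fix f
    have "U f - reflection f = 0"
      using coeff[OF U] coeff[of reflection] unitary_reflection reflection_zpow
      by (intro fourier_coeff_zero_imp_zero) (simp add: fourier_coeff_def cinner_diff_left)
    then show "U f = reflection f" by simp
  qed
qed

lemma norm_flip_operator: "norm (flip_operator f) = norm f"
proof -
  have "cinner (flip_operator f) (flip_operator f) = cinner f f"
    using unitary_reflection by (simp add: unitary_operator_def flip_operator_eq)
  then have "(norm (flip_operator f))\<^sup>2 = (norm f)\<^sup>2"
    by (simp only: cinner_same of_real_eq_iff)
  then show ?thesis by (rule power2_eq_imp_eq) simp_all
qed

section \<open>Hankel operators\<close>

text \<open>The monomial as a bounded symbol, so that its multiplication operator can be
  interchanged with that of \<phi>.\<close>

lift_definition monomial_symbol :: "int \<Rightarrow> linf" is "\<lambda>n z. z powi n"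
  by (simp add: ess_bounded_powi)

lemma linf_mult_add: "linf_mult p (f + g) = linf_mult p f + linf_mult p g"
  by transfer (auto intro!: square_integrable_mult square_integrable_add simp: distrib_left)

lemma linf_mult_scaleC: "linf_mult p (scaleC c f) = scaleC c (linf_mult p f)"
  by transfer (auto intro!: square_integrable_mult square_integrable_scale simp: mult.left_commute)

lemma linf_mult_zero: "linf_mult p 0 = 0"
  using linf_mult_scaleC[of p 0 0] by simp

lemma linf_mult_commute: "linf_mult p (linf_mult q f) = linf_mult q (linf_mult p f)"
  by transfer (auto intro!: square_integrable_mult simp: mult.left_commute)

lemma linf_mult_monomial_zpow: "linf_mult (monomial_symbol m) (zpow n) = zpow (m + n)"
proof transfer
  fix m n :: int
  have "AE z in circle_measure. z powi m * z powi n = z powi (m + n)"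
  proof (rule AE_I2)
    fix z :: complex assume "z \<in> space circle_measure"
    then have "z \<noteq> 0" by auto
    then show "z powi m * z powi n = z powi (m + n)" by (simp add: power_int_add)
  qed
  then show "square_integrable (\<lambda>z. z powi m * z powi n) \<and> square_integrable (\<lambda>z. z powi (m + n)) \<and>
      (AE z in circle_measure. z powi m * z powi n = z powi (m + n))"
    by (intro conjI square_integrable_mult ess_bounded_powi square_integrable_powi)
qed

lemma norm_linf_mult_monomial: "norm (linf_mult (monomial_symbol m) f) = norm f"
proof -
  obtain F where F: "square_integrable F" "abs_ltwo F = f" by (rule rep_ltwo)
  have sq: "square_integrable (\<lambda>z. z powi m * F z)"
    by (rule square_integrable_mult[OF ess_bounded_powi F(1)])
  have "linf_mult (monomial_symbol m) f = abs_ltwo (\<lambda>z. z powi m * F z)"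
    unfolding F(2)[symmetric] monomial_symbol_def
    using F(1) ess_bounded_powi by (simp add: linf_mult.abs_eq)
  then have "(norm (linf_mult (monomial_symbol m) f))\<^sup>2 = (\<integral>z. (cmod (z powi m * F z))\<^sup>2 \<partial>circle_measure)"
    by (simp add: norm_abs_ltwo[OF sq])
  also have "\<dots> = (\<integral>z. (cmod (F z))\<^sup>2 \<partial>circle_measure)"
    by (rule Bochner_Integration.integral_cong) (simp_all add: norm_mult norm_power_int)
  also have "\<dots> = (norm f)\<^sup>2" using norm_abs_ltwo[OF F(1)] F(2) by simp
  finally show ?thesis by (rule power2_eq_imp_eq) simp_all
qed

lemma csubspace_eventually_hardy2:
  "csubspace {p. \<exists>N. \<forall>n\<ge>N. linf_mult (monomial_symbol (int n)) p \<in> hardy2}" (is "csubspace ?Q")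
  unfolding csubspace_def
proof (intro conjI ballI allI)
  fix p q assume "p \<in> ?Q" "q \<in> ?Q"
  then obtain N N' where "\<forall>n\<ge>N. linf_mult (monomial_symbol (int n)) p \<in> hardy2"
    "\<forall>n\<ge>N'. linf_mult (monomial_symbol (int n)) q \<in> hardy2"
    by blast
  then have "\<forall>n\<ge>max N N'. linf_mult (monomial_symbol (int n)) (p + q) \<in> hardy2"
    by (simp add: linf_mult_add csubspace_add[OF csubspace_hardy2])
  then show "p + q \<in> ?Q" by blast
next
  fix c p assume "p \<in> ?Q"
  then show "scaleC c p \<in> ?Q"
    by (auto simp: linf_mult_scaleC intro: csubspace_scaleC[OF csubspace_hardy2])
qed (simp add: linf_mult_zero csubspace_0[OF csubspace_hardy2])

text \<open>Multiplying by \<open>z\<^sup>n\<close> moves a trigonometric polynomial close to \<open>\<phi>\<close> into \<open>H\<^sup>2\<close>.\<close>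

lemma hankel_zpow_tendsto_zero: "(\<lambda>n. hankel \<phi> (zpow (int n))) \<longlonglongrightarrow> 0"
proof (rule LIMSEQ_I)
  fix e :: real assume e: "e > 0"
  define f where "f = linf_mult \<phi> (zpow 0)"
  obtain p where p: "p \<in> csubspace hull range zpow" "norm (f - p) < e"
    by (rule trigonometric_approximation[OF e])
  have "csubspace hull range zpow \<subseteq> {p. \<exists>N. \<forall>n\<ge>N. linf_mult (monomial_symbol (int n)) p \<in> hardy2}"
  proof (rule hull_minimal)
    have "\<forall>n\<ge>nat (- k). linf_mult (monomial_symbol (int n)) (zpow k) \<in> hardy2" for k
      by (auto simp: linf_mult_monomial_zpow intro: zpow_in_hardy2)
    then show "range zpow \<subseteq> {p. \<exists>N. \<forall>n\<ge>N. linf_mult (monomial_symbol (int n)) p \<in> hardy2}"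
      by blast
  qed (rule csubspace_eventually_hardy2)
  with p(1) obtain N where N: "\<And>n. n \<ge> N \<Longrightarrow> linf_mult (monomial_symbol (int n)) p \<in> hardy2"
    by blast
  have "norm (hankel \<phi> (zpow (int n)) - 0) < e" if n: "n \<ge> N" for n
  proof -
    let ?z = "linf_mult (monomial_symbol (int n))"
    \<comment> \<open>Since multiplications commute, one approximation of the fixed function
      \<open>f\<close> serves all \<open>n\<close>; the power of \<open>z\<close> then acts as an
      isometry.\<close>
    have "linf_mult \<phi> (zpow (int n)) = ?z f"
      unfolding f_def using linf_mult_commute[of \<phi> "monomial_symbol (int n)" "zpow 0"]
      by (simp add: linf_mult_monomial_zpow)
    then have "norm (hankel \<phi> (zpow (int n))) = norm (?z f - orthogonal_projection hardy2 (?z f))"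
      by (simp add: hankel_def norm_flip_operator)
    also have "\<dots> \<le> norm (?z f - ?z p)"
      by (rule orthogonal_projection_minimal[OF csubspace_hardy2 closed_hardy2 N[OF n]])
    also have "?z f - ?z p = ?z (f - p)"
      using linf_mult_add[of "monomial_symbol (int n)" "f - p" p] by simp
    also have "norm \<dots> < e" using p(2) by (simp add: norm_linf_mult_monomial)
    finally show ?thesis by simp
  qed
  then show "\<exists>N. \<forall>n\<ge>N. norm (hankel \<phi> (zpow (int n)) - 0) < e" by blast
qed

theorem theorem2p9:
  fixes \<phi> :: linf
  shows "hankel \<phi> \<in> AN_operators hardy2 hardy2 \<longleftrightarrow> hankel \<phi> \<in> compact_operators hardy2 hardy2"
proof
  assume "hankel \<phi> \<in> AN_operators hardy2 hardy2"
  then show "hankel \<phi> \<in> compact_operators hardy2 hardy2"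
    by (rule AN_operator_is_compact[OF csubspace_hardy2 closed_hardy2, where e = "\<lambda>n. zpow (int n)"])
       (simp_all add: zpow_in_hardy2 cinner_zpow_tendsto_zero hankel_zpow_tendsto_zero)
qed (use compact_operators_subset_AN[OF csubspace_hardy2] in blast)

end
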